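(* Let $X$ be a real Banach space and let $A\subset X$ be a bounded set. Consider the following numbers: - $\Gamma_1=\gamma(A^{\mathcal U})$ measured in $X^{\mathcal U}$, for $\mathcal U$ a free ultrafilter on $\mathbb{N}$; - $\Gamma_2$ is the infimum of the numbers $\varepsilon>0$ such that there are no arbitrarily long finite sequences $(x_k)_1^n\subset A$, $(x_k^* )_1^n\subset B_{X^*}$ with $x_k^*(x_j)=0$ if $j<k$ and $x_k^*(x_j)>\varepsilon$ if $j\ge k$; - $\Gamma_3$ is the supremum of the numbers $\varepsilon>0$ such that for any $n\in\mathbb{N}$ there are $x_1,\dots,x_n\in A$ such that $\operatorname{d}(\operatorname{conv}\{x_1,\dots,x_k\},\operatorname{conv}\{x_{k+1},\dots,x_n\})\ge\varepsilon$ for all $k=1,\dots,n-1$. Then $\Gamma_1\le\Gamma_2\le\Gamma_3\le 2\Gamma_1$.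
   Context: $X^{\mathcal U}$ is the quotient of $\ell_\infty(X)$ by the subspace of those $(x_n)$ with $\lim_{n,\mathcal U}\|x_n\|=0$, so that the norm of the class of $(x_n)$ is $\lim_{n,\mathcal U}\|x_n\|$. For a bounded set $A\subset X$, $A^{\mathcal U}\subset X^{\mathcal U}$ is the set of elements having a representative in $A^{\mathbb N}$. For a bounded subset $A$ of a Banach space $Y$, $\gamma(A)=\inf\{\varepsilon>0:\overline{A}^{w^*}\subset Y+\varepsilon B_{Y^{**}}\}$, where the closure is the weak$^*$ closure in $Y^{**}$. $\operatorname{d}(C,D)=\inf\{\|c-d\|:c\in C,d\in D\}$ and $\operatorname{conv}$ is the convex hull. The supremum of an empty set of positive numbers is taken to be $0$. "There are no arbitrarily long sequences" means that for some $N\in\mathbb{N}$ there are no such sequences of length $n\geq N$. *)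

theory Defs
  imports "HOL-Analysis.Analysis"
begin

text \<open>
  The ultrapower depends on the ultrafilter, a term, so it cannot be a type. Normed spaces that
  need not be types are therefore given by an explicit set of vectors and operations on it.
\<close>

record 'v normed_structure =
  vecs :: "'v set"
  vadd :: "'v \<Rightarrow> 'v \<Rightarrow> 'v"
  vscale :: "real \<Rightarrow> 'v \<Rightarrow> 'v"
  vnorm :: "'v \<Rightarrow> real"

definition unit_ball :: "'v normed_structure \<Rightarrow> 'v set" where
  "unit_ball Y = {y \<in> vecs Y. vnorm Y y \<le> 1}"

text \<open>
  Functionals are made extensional (fixed to be \<open>undefined\<close> off \<^term>\<open>vecs Y\<close>), so that equality
  of elements of the dual is equality on \<^term>\<open>vecs Y\<close>.
\<close>

definition bounded_functional :: "'v normed_structure \<Rightarrow> ('v \<Rightarrow> real) \<Rightarrow> bool" where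
  "bounded_functional Y f \<longleftrightarrow>
     (\<forall>x\<in>vecs Y. \<forall>y\<in>vecs Y. f (vadd Y x y) = f x + f y) \<and>
     (\<forall>r. \<forall>x\<in>vecs Y. f (vscale Y r x) = r * f x) \<and>
     (\<exists>K. \<forall>x\<in>vecs Y. \<bar>f x\<bar> \<le> K * vnorm Y x)"

definition dual_space :: "'v normed_structure \<Rightarrow> ('v \<Rightarrow> real) normed_structure" where
  "dual_space Y = \<lparr>
     vecs = {f \<in> extensional (vecs Y). bounded_functional Y f},
     vadd = (\<lambda>f g. restrict (\<lambda>x. f x + g x) (vecs Y)),
     vscale = (\<lambda>r f. restrict (\<lambda>x. r * f x) (vecs Y)),
     vnorm = (\<lambda>f. SUP x\<in>unit_ball Y. \<bar>f x\<bar>)\<rparr>"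

abbreviation bidual_space ::
    "'v normed_structure \<Rightarrow> (('v \<Rightarrow> real) \<Rightarrow> real) normed_structure" where
  "bidual_space Y \<equiv> dual_space (dual_space Y)"

definition bidual_embedding :: "'v normed_structure \<Rightarrow> 'v \<Rightarrow> ('v \<Rightarrow> real) \<Rightarrow> real" where
  "bidual_embedding Y y = restrict (\<lambda>f. f y) (vecs (dual_space Y))"

text \<open>The topology of pointwise convergence on the dual of \<^term>\<open>Y\<close>.\<close>

definition weak_star_topology :: "'v normed_structure \<Rightarrow> ('v \<Rightarrow> real) topology" where
  "weak_star_topology Y =
     subtopology (product_topology (\<lambda>_. euclideanreal) (vecs Y)) (vecs (dual_space Y))"

definition weak_noncompactness :: "'v normed_structure \<Rightarrow> 'v set \<Rightarrow> real" where
  "weak_noncompactness Y A = Inf {\<epsilon>. \<epsilon> > 0 \<and>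
     weak_star_topology (dual_space Y) closure_of (bidual_embedding Y ` A) \<subseteq>
       {vadd (bidual_space Y) (bidual_embedding Y y) (vscale (bidual_space Y) \<epsilon> b) |y b.
          y \<in> vecs Y \<and> b \<in> unit_ball (bidual_space Y)}}"

text \<open>The quotient by a subspace \<^term>\<open>N\<close>: vectors are cosets, with the usual quotient norm.\<close>

definition coset :: "'v::real_normed_vector set \<Rightarrow> 'v \<Rightarrow> 'v set" where
  "coset N x = (\<lambda>z. x + z) ` N"

definition quotient_space :: "'v::real_normed_vector set \<Rightarrow> 'v set normed_structure" where
  "quotient_space N = \<lparr>
     vecs = range (coset N),
     vadd = (\<lambda>C D. \<Union>x\<in>C. \<Union>y\<in>D. coset N (x + y)),
     vscale = (\<lambda>r C. \<Union>x\<in>C. coset N (r *\<^sub>R x)),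
     vnorm = (\<lambda>C. INF x\<in>C. norm x)\<rparr>"

definition free_ultrafilter :: "nat filter \<Rightarrow> bool" where
  "free_ultrafilter \<U> \<longleftrightarrow>
     \<U> \<noteq> bot \<and>
     (\<forall>P. eventually P \<U> \<or> eventually (\<lambda>n. \<not> P n) \<U>) \<and>
     (\<forall>m. eventually (\<lambda>n. n \<noteq> m) \<U>)"

text \<open>
  As \<^typ>\<open>nat\<close> is discrete, \<^typ>\<open>nat \<Rightarrow>\<^sub>C 'a\<close> is the space of all bounded sequences in \<^typ>\<open>'a\<close> with
  the supremum norm.
\<close>

definition null_sequences :: "nat filter \<Rightarrow> (nat \<Rightarrow>\<^sub>C 'a::real_normed_vector) set" where
  "null_sequences \<U> = {x. ((\<lambda>n. norm (apply_bcontfun x n)) \<longlongrightarrow> 0) \<U>}"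

definition ultrapower ::
    "nat filter \<Rightarrow> (nat \<Rightarrow>\<^sub>C 'a::real_normed_vector) set normed_structure" where
  "ultrapower \<U> = quotient_space (null_sequences \<U>)"

definition ultrapower_set ::
    "nat filter \<Rightarrow> 'a::real_normed_vector set \<Rightarrow> (nat \<Rightarrow>\<^sub>C 'a) set set" where
  "ultrapower_set \<U> A =
     {C \<in> vecs (ultrapower \<U>). \<exists>x\<in>C. \<forall>n. apply_bcontfun x n \<in> A}"

definition Gamma1 :: "nat filter \<Rightarrow> 'a::banach set \<Rightarrow> real" where
  "Gamma1 \<U> A = weak_noncompactness (ultrapower \<U>) (ultrapower_set \<U> A)"

definition triangular_sequences ::
    "'a::real_normed_vector set \<Rightarrow> real \<Rightarrow> nat \<Rightarrow> bool" where
  "triangular_sequences A \<epsilon> n \<longleftrightarrow>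
     (\<exists>(x :: nat \<Rightarrow> 'a) (f :: nat \<Rightarrow> 'a \<Rightarrow>\<^sub>L real).
        (\<forall>k\<in>{1..n}. x k \<in> A \<and> norm (f k) \<le> 1) \<and>
        (\<forall>k\<in>{1..n}. \<forall>j\<in>{1..n}.
           (j < k \<longrightarrow> blinfun_apply (f k) (x j) = 0) \<and>
           (j \<ge> k \<longrightarrow> blinfun_apply (f k) (x j) > \<epsilon>)))"

definition Gamma2 :: "'a::banach set \<Rightarrow> real" where
  "Gamma2 A = Inf {\<epsilon>. \<epsilon> > 0 \<and> (\<exists>N. \<forall>n\<ge>N. \<not> triangular_sequences A \<epsilon> n)}"

definition separated_sequences ::
    "'a::real_normed_vector set \<Rightarrow> real \<Rightarrow> nat \<Rightarrow> bool" where
  "separated_sequences A \<epsilon> n \<longleftrightarrow>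
     (\<exists>x :: nat \<Rightarrow> 'a. (\<forall>k\<in>{1..n}. x k \<in> A) \<and>
        (\<forall>k\<in>{1..<n}.
           setdist (convex hull (x ` {1..k})) (convex hull (x ` {k+1..n})) \<ge> \<epsilon>))"

text \<open>\<^term>\<open>Sup {} :: real\<close> is unspecified, hence the case distinction.\<close>

definition Gamma3 :: "'a::banach set \<Rightarrow> real" where
  "Gamma3 A = (let S = {\<epsilon>. \<epsilon> > 0 \<and> (\<forall>n. separated_sequences A \<epsilon> n)}
               in if S = {} then 0 else Sup S)"

text \<open>The quotient operations act on representatives as they should, and the norm of a class in
  the ultrapower is the limit of the norms along the ultrafilter.\<close>

lemma mem_coset_iff: "y \<in> coset N x \<longleftrightarrow> y - x \<in> N"
proof
  assume "y - x \<in> N"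
  then show "y \<in> coset N x"
    unfolding coset_def by (intro image_eqI[of _ _ "y - x"]) simp_all
qed (auto simp: coset_def)

lemma coset_eq:
  assumes "subspace N" "y - x \<in> N"
  shows "coset N y = coset N x"
proof -
  have "z - y \<in> N \<longleftrightarrow> z - x \<in> N" for z
    using subspace_add[OF assms(1) _ assms(2), of "z - y"]
      subspace_diff[OF assms(1) _ assms(2), of "z - x"] by auto
  then show ?thesis by (auto simp: mem_coset_iff)
qed

lemma coset_self: "subspace N \<Longrightarrow> x \<in> coset N x"
  by (simp add: mem_coset_iff subspace_0)

lemma vadd_quotient_space:
  assumes N: "subspace N"
  shows "vadd (quotient_space N) (coset N x) (coset N y) = coset N (x + y)"
proof -
  have "coset N (x' + y') = coset N (x + y)" if "x' \<in> coset N x" "y' \<in> coset N y" for x' y'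
    using that subspace_add[OF N, of "x' - x" "y' - y"]
    by (intro coset_eq N) (simp add: mem_coset_iff algebra_simps)
  then have "(\<Union>x'\<in>coset N x. \<Union>y'\<in>coset N y. coset N (x' + y')) =
      (\<Union>x'\<in>coset N x. \<Union>y'\<in>coset N y. coset N (x + y))"
    by (intro SUP_cong refl) simp
  also have "\<dots> = coset N (x + y)"
    using coset_self[OF N, of x] coset_self[OF N, of y] by (simp only: UN_constant) auto
  finally show ?thesis
    by (simp add: quotient_space_def)
qed

lemma vscale_quotient_space:
  assumes N: "subspace N"
  shows "vscale (quotient_space N) r (coset N x) = coset N (r *\<^sub>R x)"
proof -
  have "coset N (r *\<^sub>R x') = coset N (r *\<^sub>R x)" if "x' \<in> coset N x" for x'
    using that subspace_scale[OF N, of "x' - x" r]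
    by (intro coset_eq N) (simp add: mem_coset_iff algebra_simps)
  then have "(\<Union>x'\<in>coset N x. coset N (r *\<^sub>R x')) = (\<Union>x'\<in>coset N x. coset N (r *\<^sub>R x))"
    by (intro SUP_cong refl) simp
  also have "\<dots> = coset N (r *\<^sub>R x)"
    using coset_self[OF N, of x] by (simp only: UN_constant) auto
  finally show ?thesis
    by (simp add: quotient_space_def)
qed

lemma subspace_null_sequences: "subspace (null_sequences \<U>)"
proof (rule subspaceI)
  show "0 \<in> null_sequences \<U>"
    by (simp add: null_sequences_def)
next
  fix x y :: "nat \<Rightarrow>\<^sub>C 'a"
  assume "x \<in> null_sequences \<U>" "y \<in> null_sequences \<U>"
  then show "x + y \<in> null_sequences \<U>"
    by (simp add: null_sequences_def tendsto_norm_zero_iff tendsto_add_zero)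
next
  fix r :: real and x :: "nat \<Rightarrow>\<^sub>C 'a"
  assume "x \<in> null_sequences \<U>"
  then have "((\<lambda>n. r *\<^sub>R apply_bcontfun x n) \<longlongrightarrow> r *\<^sub>R 0) \<U>"
    unfolding null_sequences_def tendsto_norm_zero_iff mem_Collect_eq
    by (rule tendsto_scaleR[OF tendsto_const])
  then show "r *\<^sub>R x \<in> null_sequences \<U>"
    by (simp only: null_sequences_def tendsto_norm_zero_iff mem_Collect_eq
        scaleR_bcontfun.rep_eq scaleR_zero_right)
qed

lemma vnorm_ultrapower:
  fixes x :: "nat \<Rightarrow>\<^sub>C 'a::real_normed_vector"
  assumes "\<U> \<noteq> bot" and lim: "((\<lambda>n. norm (apply_bcontfun x n)) \<longlongrightarrow> L) \<U>"
  shows "vnorm (ultrapower \<U>) (coset (null_sequences \<U>) x) = L"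
proof -
  let ?C = "coset (null_sequences \<U>) x"
  have lower: "L \<le> norm y" if "y \<in> ?C" for y
  proof -
    have "((\<lambda>n. apply_bcontfun y n - apply_bcontfun x n) \<longlongrightarrow> 0) \<U>"
      using that by (simp add: mem_coset_iff null_sequences_def tendsto_norm_zero_iff)
    then have "((\<lambda>n. norm (apply_bcontfun y n - apply_bcontfun x n)) \<longlongrightarrow> 0) \<U>"
      by (simp add: tendsto_norm_zero_iff)
    from tendsto_diff[OF lim this]
    have "((\<lambda>n. norm (apply_bcontfun x n) - norm (apply_bcontfun y n - apply_bcontfun x n))
            \<longlongrightarrow> L) \<U>" by simp
    moreover have "norm (apply_bcontfun x n) - norm (apply_bcontfun y n - apply_bcontfun x n)
        \<le> norm y" for n
      using norm_bounded[of y n]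
        norm_triangle_ineq2[of "apply_bcontfun x n" "apply_bcontfun y n"]
      by (simp add: norm_minus_commute)
    ultimately show ?thesis
      by (intro tendsto_upperbound[OF _ _ \<open>\<U> \<noteq> bot\<close>]) auto
  qed
  have upper: "\<exists>y\<in>?C. norm y \<le> L + e" if "e > 0" for e
  proof -
    define g where
      "g n = (if norm (apply_bcontfun x n) \<le> L + e then apply_bcontfun x n else 0)" for n
    have "0 \<le> L"
      by (rule tendsto_lowerbound[OF lim _ \<open>\<U> \<noteq> bot\<close>]) auto
    then have g: "norm (g n) \<le> L + e" for n
      using \<open>e > 0\<close> by (simp add: g_def)
    then have "g \<in> bcontfun"
      by (auto simp: bcontfun_def bounded_iff)
    then have app: "apply_bcontfun (Bcontfun g) = g"
      by (rule Bcontfun_inverse)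
    have "eventually (\<lambda>n. norm (apply_bcontfun x n) < L + e) \<U>"
      using order_tendstoD(2)[OF lim] \<open>e > 0\<close> by simp
    then have "eventually (\<lambda>n. g n - apply_bcontfun x n = 0) \<U>"
      by eventually_elim (simp add: g_def)
    then have "((\<lambda>n. g n - apply_bcontfun x n) \<longlongrightarrow> 0) \<U>"
      by (rule tendsto_eventually)
    then have "Bcontfun g \<in> ?C"
      by (simp add: mem_coset_iff null_sequences_def app tendsto_norm_zero_iff)
    moreover have "norm (Bcontfun g) \<le> L + e"
      by (rule norm_bound) (simp add: app g)
    ultimately show ?thesis by blast
  qed
  have "(INF y\<in>?C. norm y) = L"
  proof (rule cInf_eq)
    show "L \<le> a" if "a \<in> norm ` ?C" for a
      using that lower by auto
    show "b \<le> L" if "\<And>a. a \<in> norm ` ?C \<Longrightarrow> b \<le> a" for b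
    proof (rule field_le_epsilon)
      fix e :: real assume "e > 0"
      with upper obtain y where "y \<in> ?C" "norm y \<le> L + e" by blast
      with that[of "norm y"] show "b \<le> L + e" by simp
    qed
  qed
  then show ?thesis
    by (simp add: ultrapower_def quotient_space_def)
qed

end

theory Submission
  imports Defs
begin

text \<open>
  The dual of the ultrapower is the annihilator \<open>D\<close> of the null sequences in the dual of
  \<open>\<ell>\<^sub>\<infinity>(X)\<close>, so a point of the bidual is a bounded linear functional \<open>\<zeta>\<close> on \<open>D\<close>.

  If \<open>\<Gamma>\<^sub>1 > \<epsilon>\<close>, some \<open>\<zeta>\<close> in the weak* closure of \<open>A\<^sup>\<U>\<close> is farther than \<open>\<epsilon>\<close> from the ultrapower.
  By Helly's theorem there is a functional in the unit ball of \<open>D\<close> that vanishes on the vectors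
  already chosen and on which \<open>\<zeta>\<close> exceeds \<open>\<epsilon>\<close>; a point of \<open>A\<^sup>\<U>\<close> close to \<open>\<zeta>\<close> is the next vector.
  The resulting finite triangular system lives in the ultrapower; by the Hahn--Banach theorem its
  existence amounts to norm estimates for linear combinations, and these pass to the coordinates.

  The functional \<open>x\<^sub>k\<^sup>*\<close> separates the two convex hulls, whence \<open>\<Gamma>\<^sub>2 \<le> \<Gamma>\<^sub>3\<close>.

  Separated sequences of all lengths are the coordinates of an infinite separated sequence \<open>y\<^sub>k\<close> in
  \<open>A\<^sup>\<U>\<close>. Let \<open>\<zeta>\<close> be its weak* limit along \<open>\<U>\<close>. A vector within \<open>\<delta>\<close> of \<open>\<zeta>\<close> is within \<open>\<delta>\<close> of the
  convex hull of every tail of \<open>y\<^sub>k\<close>, so two of these hulls are within \<open>2\<delta>\<close> of each other.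
\<close>

section \<open>Sublinear functionals and the Mazur--Orlicz theorem\<close>

text \<open>Positive homogeneity is demanded only as an inequality, which is all that has to be
  checked for infima; equality is recovered in \<open>sublinear_scale\<close>.\<close>

definition sublinear :: "('v::real_vector \<Rightarrow> real) \<Rightarrow> bool" where
  "sublinear p \<longleftrightarrow>
     (\<forall>x y. p (x + y) \<le> p x + p y) \<and> (\<forall>t\<ge>0. \<forall>x. p (t *\<^sub>R x) \<le> t * p x)"

lemma sublinear_add: "sublinear p \<Longrightarrow> p (x + y) \<le> p x + p y"
  and sublinear_scale_le: "sublinear p \<Longrightarrow> t \<ge> 0 \<Longrightarrow> p (t *\<^sub>R x) \<le> t * p x"
  by (auto simp: sublinear_def)

lemma sublinear_zero: "sublinear p \<Longrightarrow> p 0 = 0"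
  using sublinear_add[of p 0 0] sublinear_scale_le[of p 0 0] by simp

lemma sublinear_minus: "sublinear p \<Longrightarrow> - p (- x) \<le> p x"
  using sublinear_add[of p x "- x"] sublinear_zero[of p] by simp

lemma sublinear_scale:
  assumes "sublinear p" "t \<ge> 0"
  shows "p (t *\<^sub>R x) = t * p x"
proof (cases "t = 0")
  case False
  then have "p x \<le> (1 / t) * p (t *\<^sub>R x)"
    using sublinear_scale_le[OF assms(1), of "1 / t" "t *\<^sub>R x"] assms(2) by simp
  then show ?thesis
    using sublinear_scale_le[OF assms, of x] assms(2) False by (simp add: field_simps)
qed (use sublinear_zero assms in simp)

definition cone_closed :: "'v::real_vector set \<Rightarrow> bool" where
  "cone_closed G \<longleftrightarrow>
     0 \<in> G \<and> (\<forall>g\<in>G. \<forall>h\<in>G. g + h \<in> G) \<and> (\<forall>t\<ge>0. \<forall>g\<in>G. t *\<^sub>R g \<in> G)"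

text \<open>A pair \<open>(v, r)\<close> in \<open>G\<close> stands for the requirement
  \<open>r \<le> f v\<close>. A linear \<open>f \<le> p\<close> meeting it satisfies
  \<open>f x = f (x + v) - f v \<le> p (x + v) - r\<close>, so the infimum is an upper bound for
  \<open>f\<close> that accounts for all requirements at once.\<close>

definition cone_infimum ::
    "('v::real_vector \<Rightarrow> real) \<Rightarrow> ('v \<times> real) set \<Rightarrow> 'v \<Rightarrow> real" where
  "cone_infimum p G x = (INF g\<in>G. p (x + fst g) - snd g)"

context
  fixes p :: "'v::real_vector \<Rightarrow> real" and G :: "('v \<times> real) set"
  assumes p: "sublinear p" and G: "cone_closed G"
    and dom: "\<And>v r. (v, r) \<in> G \<Longrightarrow> r \<le> p v"
begin

lemma cone_infimum_lower:
  assumes "(v, r) \<in> G"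
  shows "cone_infimum p G x \<le> p (x + v) - r"
proof -
  \<comment> \<open>Domination gives \<open>r \<le> p v \<le> p (x + v) + p (- x)\<close>, a lower
    bound that does not depend on the pair.\<close>
  have "bdd_below ((\<lambda>g. p (x + fst g) - snd g) ` G)"
  proof (rule bdd_belowI2[where m = "- p (- x)"])
    fix g assume "g \<in> G"
    then have "snd g \<le> p (fst g)"
      using dom[of "fst g" "snd g"] by simp
    then show "- p (- x) \<le> p (x + fst g) - snd g"
      using sublinear_add[OF p, of "x + fst g" "- x"] by simp
  qed
  from cINF_lower[OF this assms] show ?thesis
    by (simp add: cone_infimum_def)
qed

lemma cone_infimum_greatest:
  assumes "\<And>v r. (v, r) \<in> G \<Longrightarrow> m \<le> p (x + v) - r"
  shows "m \<le> cone_infimum p G x"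
  unfolding cone_infimum_def
proof (rule cINF_greatest)
  show "G \<noteq> {}"
    using G by (auto simp: cone_closed_def)
qed (use assms in auto)

lemma cone_infimum_le: "cone_infimum p G x \<le> p x"
  using cone_infimum_lower[of 0 0 x] G by (simp add: cone_closed_def zero_prod_def)

text \<open>Requirements in \<open>G\<close> may be added and scaled by \<open>t \<ge> 0\<close>, so
  subadditivity and homogeneity of \<open>p\<close> carry over to the infimum.\<close>

lemma sublinear_cone_infimum: "sublinear (cone_infimum p G)"
  unfolding sublinear_def
proof (intro conjI allI impI)
  fix x y
  have "cone_infimum p G (x + y) - (p (y + w) - s) \<le> p (x + v) - r"
    if "(v, r) \<in> G" "(w, s) \<in> G" for v r w s
  proof -
    have "(v, r) + (w, s) \<in> G"
      using that G unfolding cone_closed_def by blast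
    then have "cone_infimum p G (x + y) \<le> p (x + y + (v + w)) - (r + s)"
      by (intro cone_infimum_lower) simp
    also have "\<dots> \<le> p (x + v) + p (y + w) - (r + s)"
      using sublinear_add[OF p, of "x + v" "y + w"] by (simp add: algebra_simps)
    finally show ?thesis by simp
  qed
  then have "cone_infimum p G (x + y) - (p (y + w) - s) \<le> cone_infimum p G x"
    if "(w, s) \<in> G" for w s
    using that by (intro cone_infimum_greatest) blast
  then have "cone_infimum p G (x + y) - cone_infimum p G x \<le> cone_infimum p G y"
    by (intro cone_infimum_greatest) (simp add: algebra_simps)
  then show "cone_infimum p G (x + y) \<le> cone_infimum p G x + cone_infimum p G y"
    by simp
next
  fix t :: real and x
  assume "t \<ge> 0"
  show "cone_infimum p G (t *\<^sub>R x) \<le> t * cone_infimum p G x"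
  proof (cases "t = 0")
    case True
    then show ?thesis
      using cone_infimum_le[of 0] sublinear_zero[OF p] by simp
  next
    case False
    have "cone_infimum p G (t *\<^sub>R x) / t \<le> p (x + v) - r" if "(v, r) \<in> G" for v r
    proof -
      have "t *\<^sub>R (v, r) \<in> G"
        using that G \<open>t \<ge> 0\<close> unfolding cone_closed_def by blast
      then have "cone_infimum p G (t *\<^sub>R x) \<le> p (t *\<^sub>R (x + v)) - t * r"
        using cone_infimum_lower[of "t *\<^sub>R v" "t * r" "t *\<^sub>R x"] by (simp add: scaleR_add_right)
      also have "\<dots> = t * (p (x + v) - r)"
        using sublinear_scale[OF p \<open>t \<ge> 0\<close>, of "x + v"] by (simp add: right_diff_distrib)
      finally show ?thesis
        using False \<open>t \<ge> 0\<close> by (simp add: field_simps)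
    qed
    then have "cone_infimum p G (t *\<^sub>R x) / t \<le> cone_infimum p G x"
      by (rule cone_infimum_greatest)
    then show ?thesis
      using False \<open>t \<ge> 0\<close> by (simp add: field_simps)
  qed
qed

end

text \<open>Zorn's lemma applies because the pointwise infimum of a chain is finite, being bounded
  below by \<open>- p (- x)\<close>, and is again sublinear.\<close>

lemma sublinear_minimal_exists:
  fixes p :: "'v::real_vector \<Rightarrow> real"
  assumes p: "sublinear p"
  shows "\<exists>q. sublinear q \<and> q \<le> p \<and> (\<forall>r. sublinear r \<and> r \<le> q \<longrightarrow> r = q)"
proof -
  let ?S = "{q. sublinear q \<and> q \<le> p}"
  \<comment> \<open>The order is reversed, so that the maximal element given by Zorn's lemma is a
    minimal functional.\<close>
  let ?P = "\<lambda>f g :: 'v \<Rightarrow> real. g \<le> f"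
  have "\<exists>m\<in>?S. \<forall>a\<in>?S. ?P m a \<longrightarrow> a = m"
  proof (rule predicate_Zorn)
    show "partial_order_on ?S (relation_of ?P ?S)"
      by (rule partial_order_on_relation_ofI) auto
    fix C assume "C \<in> Chains (relation_of ?P ?S)"
    then have CS: "C \<subseteq> ?S" and chain: "\<And>f g. f \<in> C \<Longrightarrow> g \<in> C \<Longrightarrow> f \<le> g \<or> g \<le> f"
      by (auto simp: Chains_def relation_of_def)
    show "\<exists>u\<in>?S. \<forall>a\<in>C. u \<le> a"
    proof (cases "C = {}")
      case True
      then show ?thesis using p by auto
    next
      case False
      define u where "u x = (INF q\<in>C. q x)" for x
      have lower: "u x \<le> q x" if "q \<in> C" for q x
        unfolding u_def
      proof (rule cINF_lower[OF bdd_belowI2[where m = "- p (- x)"] that])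
        fix r assume "r \<in> C"
        then have "sublinear r" "r (- x) \<le> p (- x)"
          using CS by (auto simp: le_fun_def)
        then show "- p (- x) \<le> r x"
          using sublinear_minus[of r x] by simp
      qed
      have greatest: "m \<le> u x" if "\<And>q. q \<in> C \<Longrightarrow> m \<le> q x" for m x
        unfolding u_def by (rule cINF_greatest[OF False that])
      have "sublinear u"
        unfolding sublinear_def
      proof (intro conjI allI impI)
        fix x y
        \<comment> \<open>The smaller of \<open>q\<close> and \<open>r\<close> lies below both, and
          its own subadditivity bounds the mixed sum.\<close>
        have *: "u (x + y) - r y \<le> q x" if qr: "q \<in> C" "r \<in> C" for q r
        proof -
          have "\<exists>s\<in>C. s \<le> q \<and> s \<le> r"
            using chain[OF qr] qr by blast
          then obtain s where s: "s \<in> C" "s x \<le> q x" "s y \<le> r y"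
            by (auto simp: le_fun_def)
          then have "s (x + y) \<le> s x + s y"
            using CS by (auto intro: sublinear_add)
          then show ?thesis
            using s lower[OF s(1), of "x + y"] by simp
        qed
        have "u (x + y) - r y \<le> u x" if "r \<in> C" for r
          by (rule greatest) (use * that in blast)
        then have "u (x + y) - u x \<le> r y" if "r \<in> C" for r
          using that by (simp add: algebra_simps)
        then have "u (x + y) - u x \<le> u y"
          by (rule greatest)
        then show "u (x + y) \<le> u x + u y" by simp
      next
        fix t :: real and x
        assume t: "t \<ge> 0"
        have *: "u (t *\<^sub>R x) \<le> t * q x" if "q \<in> C" for q
          using that CS lower[OF that, of "t *\<^sub>R x"] sublinear_scale_le[OF _ t, of q x] by force
        show "u (t *\<^sub>R x) \<le> t * u x"
        proof (cases "t = 0")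
          case True
          then show ?thesis using * False by auto
        next
          case tn: False
          then have "u (t *\<^sub>R x) / t \<le> u x"
            using * t by (intro greatest) (simp add: field_simps)
          then show ?thesis
            using tn t by (simp add: field_simps)
        qed
      qed
      moreover obtain q where "q \<in> C" using False by blast
      then have "u \<le> p"
        using CS lower[of q] order_trans unfolding le_fun_def by blast
      ultimately show ?thesis
        using lower by (auto simp: le_fun_def)
    qed
  qed
  then show ?thesis
    using order_trans by blast
qed

text \<open>A minimal sublinear functional is linear: \<open>cone_infimum\<close> for a ray cannot
  lower it, and this yields the missing superadditivity.\<close>

theorem hahn_banach_sublinear:
  fixes p :: "'v::real_vector \<Rightarrow> real"
  assumes "sublinear p"
  shows "\<exists>f. linear f \<and> f \<le> p"
proof -
  obtain q where q: "sublinear q" "q \<le> p" and min: "\<And>r. sublinear r \<Longrightarrow> r \<le> q \<Longrightarrow> r = q"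
    using sublinear_minimal_exists[OF assms] by blast
  have add: "q (x + a) = q x + q a" for x a
  proof -
    \<comment> \<open>The requirements are the values of \<open>q\<close> itself along the ray
      through \<open>a\<close>. By minimality the infimum is \<open>q\<close>, and its bound at
      \<open>t = 1\<close> reads \<open>q x \<le> q (x + a) - q a\<close>.\<close>
    let ?G = "{(t *\<^sub>R a, t * q a) |t. t \<ge> 0}"
    have G: "cone_closed ?G"
      unfolding cone_closed_def
    proof (intro conjI ballI allI impI)
      show "0 \<in> ?G" by (auto simp: zero_prod_def intro!: exI[of _ 0])
      show "g + h \<in> ?G" if gh: "g \<in> ?G" "h \<in> ?G" for g h
      proof -
        obtain s t where "g = (s *\<^sub>R a, s * q a)" "h = (t *\<^sub>R a, t * q a)" "s \<ge> 0" "t \<ge> 0"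
          using gh by blast
        then show ?thesis
          by (auto intro!: exI[of _ "s + t"] simp: algebra_simps)
      qed
      show "t *\<^sub>R g \<in> ?G" if "t \<ge> 0" "g \<in> ?G" for t :: real and g
        using that by (auto simp: mult.assoc[symmetric])
    qed
    have dom: "r \<le> q v" if "(v, r) \<in> ?G" for v r
      using that sublinear_scale[OF q(1)] by auto
    have "cone_infimum q ?G = q"
      by (intro min sublinear_cone_infimum q G dom le_funI cone_infimum_le)
    then have "q x \<le> q (x + a) - q a"
      using cone_infimum_lower[OF q(1) G dom, of a "q a" x] by (force intro!: exI[of _ 1])
    then show ?thesis
      using sublinear_add[OF q(1), of x a] by simp
  qed
  have neg: "q (- x) = - q x" for x
    using add[of x "- x"] sublinear_zero[OF q(1)] by simp
  have "q (r *\<^sub>R x) = r * q x" for r x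
  proof (cases "r \<ge> 0")
    case True
    then show ?thesis by (rule sublinear_scale[OF q(1)])
  next
    case False
    then have "q ((- r) *\<^sub>R x) = (- r) * q x"
      by (intro sublinear_scale[OF q(1)]) simp
    then show ?thesis
      using neg[of "r *\<^sub>R x"] by simp
  qed
  then have "linear q"
    by (intro linearI add) simp
  with q show ?thesis by blast
qed

text \<open>
  Extension from a subspace and separation from a convex set are both obtained by choosing the
  cone appropriately: its elements are the prescribed lower bounds for the functional.
\<close>

theorem mazur_orlicz:
  fixes p :: "'v::real_vector \<Rightarrow> real"
  assumes p: "sublinear p" and G: "cone_closed G"
    and dom: "\<And>v r. (v, r) \<in> G \<Longrightarrow> r \<le> p v"
  obtains f where "linear f" "\<And>x. f x \<le> p x" "\<And>v r. (v, r) \<in> G \<Longrightarrow> r \<le> f v"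
proof -
  obtain f where f: "linear f" "\<And>x. f x \<le> cone_infimum p G x"
    using hahn_banach_sublinear[OF sublinear_cone_infimum[OF p G dom]] by (auto simp: le_fun_def)
  show thesis
  proof (rule that[OF f(1)])
    show "f x \<le> p x" for x
      using f(2)[of x] cone_infimum_le[OF p G dom, of x] by linarith
    \<comment> \<open>At \<open>- v\<close> the infimum is at most \<open>p 0 - r = - r\<close>,
      whence \<open>f (- v) \<le> - r\<close>.\<close>
    show "r \<le> f v" if "(v, r) \<in> G" for v r
      using f(2)[of "- v"] cone_infimum_lower[OF p G dom that, of "- v"]
        sublinear_zero[OF p] linear_neg[OF f(1), of v] by simp
  qed
qed

text \<open>A sum \<open>s *\<^sub>R g + t *\<^sub>R h\<close> is \<open>s + t\<close> times a
  convex combination of \<open>g\<close> and \<open>h\<close>.\<close>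

lemma cone_closed_generated:
  fixes S :: "'v::real_vector set"
  assumes "convex S" "S \<noteq> {}"
  shows "cone_closed {t *\<^sub>R g |t g. t \<ge> 0 \<and> g \<in> S}" (is "cone_closed ?G")
  unfolding cone_closed_def
proof (intro conjI ballI allI impI)
  obtain s0 where s0: "s0 \<in> S" using assms(2) by blast
  then show zero: "0 \<in> ?G"
    by (force intro!: exI[of _ 0] exI[of _ s0])
  fix u v assume "u \<in> ?G" "v \<in> ?G"
  then obtain s t g h where st: "u = s *\<^sub>R g" "v = t *\<^sub>R h" "0 \<le> s" "0 \<le> t" "g \<in> S" "h \<in> S"
    by blast
  show "u + v \<in> ?G"
  proof (cases "s + t = 0")
    case True
    then have "s = 0" "t = 0" using st by simp_all
    then show ?thesis using zero st by simp
  next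
    case False
    have "(s / (s + t)) *\<^sub>R g + (t / (s + t)) *\<^sub>R h \<in> S"
      using st False by (intro convexD[OF assms(1)]) (auto simp: add_divide_distrib[symmetric])
    moreover have "u + v = (s + t) *\<^sub>R ((s / (s + t)) *\<^sub>R g + (t / (s + t)) *\<^sub>R h)"
      using False by (simp add: scaleR_add_right st)
    ultimately show ?thesis
      using st by (intro CollectI exI[of _ "s + t"]) auto
  qed
next
  fix t :: real and u assume "t \<ge> 0" "u \<in> ?G"
  then show "t *\<^sub>R u \<in> ?G"
    by (fastforce intro: mult_nonneg_nonneg)
qed

text \<open>The cone is the one generated by \<open>C \<times> {\<delta>}\<close>; homogeneity of
  \<open>p\<close> extends the hypothesis from \<open>C\<close> to all of it.\<close>

lemma separation_from_convex:
  fixes p :: "'v::real_vector \<Rightarrow> real"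
  assumes p: "sublinear p" and C: "convex C" "C \<noteq> {}" and le: "\<And>c. c \<in> C \<Longrightarrow> \<delta> \<le> p c"
  obtains f where "linear f" "\<And>x. f x \<le> p x" "\<And>c. c \<in> C \<Longrightarrow> \<delta> \<le> f c"
proof -
  let ?G = "{t *\<^sub>R g |t g. t \<ge> 0 \<and> g \<in> C \<times> {\<delta>}}"
  have G: "cone_closed ?G"
    by (rule cone_closed_generated) (use C in \<open>auto intro: convex_Times\<close>)
  have dom: "r \<le> p v" if "(v, r) \<in> ?G" for v r
    using that le by (auto simp: sublinear_scale[OF p] mult_left_mono)
  obtain f where f: "linear f" "\<And>x. f x \<le> p x" "\<And>v r. (v, r) \<in> ?G \<Longrightarrow> r \<le> f v"
    using mazur_orlicz[OF p G dom] by blast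
  show thesis
  proof (rule that[OF f(1,2)])
    fix c assume "c \<in> C"
    then have "(c, \<delta>) \<in> ?G"
      by (intro CollectI exI[of _ 1] exI[of _ "(c, \<delta>)"]) simp
    then show "\<delta> \<le> f c" by (rule f(3))
  qed
qed

lemma sublinear_norm: "K \<ge> 0 \<Longrightarrow> sublinear (\<lambda>x :: 'v::real_normed_vector. K * norm x)"
  by (auto simp: sublinear_def ring_distribs[symmetric] intro!: mult_left_mono norm_triangle_ineq)

lemma linear_le_norm_blinfun:
  fixes f :: "'v::real_normed_vector \<Rightarrow> real"
  assumes f: "linear f" and le: "\<And>x. f x \<le> norm x"
  obtains F where "\<And>x. blinfun_apply F x = f x" "norm F \<le> 1"
proof -
  have abs: "\<bar>f x\<bar> \<le> norm x" for x
    using le[of x] le[of "- x"] linear_neg[OF f, of x] by simp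
  have "bounded_linear f"
    by (rule bounded_linear_intro[where K = 1])
      (use abs f in \<open>simp_all add: linear_add linear_cmul\<close>)
  then have app: "blinfun_apply (Blinfun f) = f"
    by (rule bounded_linear_Blinfun_apply)
  show thesis
    by (rule that[of "Blinfun f"]) (auto simp: app abs intro!: norm_blinfun_bound)
qed

section \<open>The dual and the bidual of a quotient space\<close>

definition annihilator :: "'v::real_normed_vector set \<Rightarrow> ('v \<Rightarrow>\<^sub>L real) set" where
  "annihilator N = {F. \<forall>x\<in>N. blinfun_apply F x = 0}"

text \<open>For \<open>F\<close> in the annihilator the chosen representative is immaterial. The
  restriction makes the result extensional, as \<open>dual_space\<close> demands.\<close>

definition quotient_functional ::
    "'v::real_normed_vector set \<Rightarrow> ('v \<Rightarrow>\<^sub>L real) \<Rightarrow> 'v set \<Rightarrow> real" where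
  "quotient_functional N F =
     restrict (\<lambda>C. blinfun_apply F (SOME x. x \<in> C)) (vecs (quotient_space N))"

lemma subspace_annihilator: "subspace (annihilator N)"
  by (auto simp: subspace_def annihilator_def blinfun.add_left blinfun.scaleR_left)

lemma annihilator_cong: "F \<in> annihilator N \<Longrightarrow> y - x \<in> N \<Longrightarrow> blinfun_apply F y = blinfun_apply F x"
  by (auto simp: annihilator_def blinfun.diff_right)

lemma vecs_quotient_space: "vecs (quotient_space N) = range (coset N)"
  by (simp add: quotient_space_def)

lemma quotient_functional_coset:
  assumes "subspace N" "F \<in> annihilator N"
  shows "quotient_functional N F (coset N x) = blinfun_apply F x"
proof -
  have "(SOME z. z \<in> coset N x) \<in> coset N x"
    using coset_self[OF assms(1)] by (rule someI)
  then show ?thesis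
    using annihilator_cong[OF assms(2)]
    by (simp add: quotient_functional_def vecs_quotient_space mem_coset_iff)
qed

lemma inj_on_quotient_functional:
  assumes "subspace N"
  shows "inj_on (quotient_functional N) (annihilator N)"
  by (rule inj_onI, rule blinfun_eqI) (metis assms quotient_functional_coset)

lemma vnorm_quotient_space: "vnorm (quotient_space N) C = (INF x\<in>C. norm x)"
  by (simp add: quotient_space_def)

lemma vnorm_quotient_space_nonneg:
  assumes "subspace N" "C \<in> vecs (quotient_space N)"
  shows "0 \<le> vnorm (quotient_space N) C"
  using assms coset_self[OF assms(1)] unfolding vnorm_quotient_space vecs_quotient_space
  by (intro cINF_greatest) auto

lemma vnorm_coset_le: "subspace N \<Longrightarrow> vnorm (quotient_space N) (coset N x) \<le> norm x"
  unfolding vnorm_quotient_space by (rule cINF_lower[OF bdd_belowI2[where m = 0] coset_self]) auto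

text \<open>\<open>F\<close> is constant on a coset, so the operator norm estimate may be applied to
  every representative and the infimum taken.\<close>

lemma annihilator_abs_le:
  assumes N: "subspace N" and F: "F \<in> annihilator N"
  shows "\<bar>blinfun_apply F x\<bar> \<le> norm F * vnorm (quotient_space N) (coset N x)"
proof (cases "norm F = 0")
  case True
  then show ?thesis by simp
next
  case False
  have "\<bar>blinfun_apply F x\<bar> / norm F \<le> vnorm (quotient_space N) (coset N x)"
    unfolding vnorm_quotient_space
  proof (rule cINF_greatest)
    show "coset N x \<noteq> {}" using coset_self[OF N] by blast
    fix y assume "y \<in> coset N x"
    then have "blinfun_apply F y = blinfun_apply F x"
      using annihilator_cong[OF F] by (simp add: mem_coset_iff)
    then show "\<bar>blinfun_apply F x\<bar> / norm F \<le> norm y"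
      using norm_blinfun[of F y] False by (simp add: divide_le_eq mult.commute)
  qed
  then show ?thesis
    using False by (simp add: divide_le_eq mult.commute)
qed

text \<open>Composed with the quotient map, a bounded functional on the quotient becomes one on the
  whole space that kills \<open>N\<close>, since \<open>N\<close> is the zero coset. Conversely,
  every functional killing \<open>N\<close> descends.\<close>

lemma vecs_dual_quotient_space:
  assumes N: "subspace N"
  shows "vecs (dual_space (quotient_space N)) = quotient_functional N ` annihilator N"
proof (intro equalityI subsetI)
  fix f assume "f \<in> vecs (dual_space (quotient_space N))"
  then have ext: "f \<in> extensional (range (coset N))"
    and "bounded_functional (quotient_space N) f"
    by (simp_all add: dual_space_def vecs_quotient_space)
  then have add: "f (coset N (x + y)) = f (coset N x) + f (coset N y)"
    and scale: "f (coset N (r *\<^sub>R x)) = r * f (coset N x)"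
    and "\<exists>K. \<forall>x. \<bar>f (coset N x)\<bar> \<le> K * vnorm (quotient_space N) (coset N x)" for x y r
    by (auto simp: bounded_functional_def vecs_quotient_space vadd_quotient_space[OF N]
        vscale_quotient_space[OF N])
  then obtain K where K: "\<And>x. \<bar>f (coset N x)\<bar> \<le> K * vnorm (quotient_space N) (coset N x)"
    by blast
  have "\<bar>f (coset N x)\<bar> \<le> norm x * \<bar>K\<bar>" for x
  proof -
    have "\<bar>f (coset N x)\<bar> \<le> \<bar>K\<bar> * vnorm (quotient_space N) (coset N x)"
      using vnorm_quotient_space_nonneg[OF N, of "coset N x"]
      by (intro order_trans[OF K] mult_right_mono) (auto simp: vecs_quotient_space)
    also have "\<dots> \<le> \<bar>K\<bar> * norm x"
      by (intro mult_left_mono vnorm_coset_le N) simp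
    finally show ?thesis by (simp add: mult.commute)
  qed
  then have "bounded_linear (\<lambda>x. f (coset N x))"
    by (intro bounded_linear_intro[where K = "\<bar>K\<bar>"]) (simp_all add: add scale)
  then have app: "blinfun_apply (Blinfun (\<lambda>x. f (coset N x))) = (\<lambda>x. f (coset N x))"
    by (rule bounded_linear_Blinfun_apply)
  define F where "F = Blinfun (\<lambda>x. f (coset N x))"
  have F: "F \<in> annihilator N"
    unfolding annihilator_def
  proof (intro CollectI ballI)
    fix x assume "x \<in> N"
    then have "coset N x = coset N 0"
      by (intro coset_eq N) simp
    then show "blinfun_apply F x = 0"
      using scale[of 0 0] by (simp add: F_def app)
  qed
  have "f = quotient_functional N F"
  proof (rule extensionalityI[OF ext])
    show "quotient_functional N F \<in> extensional (range (coset N))"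
      by (simp add: quotient_functional_def vecs_quotient_space)
  qed (use quotient_functional_coset[OF N F] in \<open>auto simp: F_def app\<close>)
  with F show "f \<in> quotient_functional N ` annihilator N" by blast
next
  fix f assume "f \<in> quotient_functional N ` annihilator N"
  then obtain F where F: "F \<in> annihilator N" and f: "f = quotient_functional N F" by blast
  have "bounded_functional (quotient_space N) f"
    unfolding bounded_functional_def vecs_quotient_space f
  proof (intro conjI ballI allI)
    show "\<exists>K. \<forall>C\<in>range (coset N). \<bar>quotient_functional N F C\<bar> \<le> K * vnorm (quotient_space N) C"
      using annihilator_abs_le[OF N F] quotient_functional_coset[OF N F] by auto
  qed (auto simp: vadd_quotient_space[OF N] vscale_quotient_space[OF N]
      quotient_functional_coset[OF N F] blinfun.add_right blinfun.scaleR_right)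
  then show "f \<in> vecs (dual_space (quotient_space N))"
    by (simp add: dual_space_def f) (simp add: quotient_functional_def)
qed

lemma vadd_quotient_functional:
  assumes N: "subspace N" and "F \<in> annihilator N" "G \<in> annihilator N"
  shows "vadd (dual_space (quotient_space N)) (quotient_functional N F) (quotient_functional N G) =
    quotient_functional N (F + G)"
  unfolding dual_space_def
  by (rule extensionalityI[where A = "vecs (quotient_space N)"])
    (use assms subspace_add[OF subspace_annihilator, of F N G] in
      \<open>auto simp: quotient_functional_coset vecs_quotient_space blinfun.add_left\<close>,
      simp add: quotient_functional_def vecs_quotient_space)

lemma vscale_quotient_functional:
  assumes N: "subspace N" and "F \<in> annihilator N"
  shows "vscale (dual_space (quotient_space N)) r (quotient_functional N F) =
    quotient_functional N (r *\<^sub>R F)"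
  unfolding dual_space_def
  by (rule extensionalityI[where A = "vecs (quotient_space N)"])
    (use assms subspace_scale[OF subspace_annihilator, of F N r] in
      \<open>auto simp: quotient_functional_coset vecs_quotient_space blinfun.scaleR_left\<close>,
      simp add: quotient_functional_def vecs_quotient_space)

text \<open>The identification is isometric. One estimate is \<open>annihilator_abs_le\<close>; for
  the other, the quotient map sends the unit ball into the unit ball, so the supremum tests all
  normalized vectors.\<close>

lemma vnorm_quotient_functional:
  assumes N: "subspace N" and F: "F \<in> annihilator N"
  shows "vnorm (dual_space (quotient_space N)) (quotient_functional N F) = norm F"
proof -
  let ?Y = "quotient_space N" and ?f = "quotient_functional N F"
  have le: "\<bar>?f C\<bar> \<le> norm F" if C: "C \<in> unit_ball ?Y" for C
  proof -
    obtain x where x: "C = coset N x" "vnorm ?Y (coset N x) \<le> 1"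
      using C by (auto simp: unit_ball_def vecs_quotient_space)
    have "\<bar>?f C\<bar> \<le> norm F * vnorm ?Y (coset N x)"
      using annihilator_abs_le[OF N F] by (simp add: x quotient_functional_coset[OF N F])
    also have "\<dots> \<le> norm F * 1"
      by (intro mult_left_mono x) simp
    finally show ?thesis by simp
  qed
  then have bdd: "bdd_above ((\<lambda>C. \<bar>?f C\<bar>) ` unit_ball ?Y)"
    by (rule bdd_aboveI2)
  have ball: "coset N x \<in> unit_ball ?Y" if "norm x \<le> 1" for x
    using vnorm_coset_le[OF N, of x] that by (simp add: unit_ball_def vecs_quotient_space)
  let ?S = "SUP C\<in>unit_ball ?Y. \<bar>?f C\<bar>"
  have upper: "\<bar>blinfun_apply F x\<bar> \<le> ?S" if "norm x \<le> 1" for x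
    using cSUP_upper[OF ball[OF that] bdd] by (simp add: quotient_functional_coset[OF N F])
  have "norm F \<le> ?S"
  proof (rule norm_blinfun_bound)
    show "0 \<le> ?S"
      using upper[of 0] by simp
    show "norm (blinfun_apply F x) \<le> ?S * norm x" for x
      using upper[of "sgn x"]
      by (cases "x = 0") (simp_all add: sgn_div_norm blinfun.scaleR_right abs_mult field_simps)
  qed
  moreover have "?S \<le> norm F"
    using ball[of 0] le by (intro cSUP_least) auto
  ultimately show ?thesis
    by (simp add: dual_space_def)
qed

lemma unit_ball_dual_quotient_space:
  assumes N: "subspace N"
  shows "unit_ball (dual_space (quotient_space N)) =
    quotient_functional N ` {F \<in> annihilator N. norm F \<le> 1}"
  unfolding unit_ball_def vecs_dual_quotient_space[OF N]
  using vnorm_quotient_functional[OF N] by auto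

section \<open>The bidual of a quotient as functionals on the annihilator\<close>

definition bounded_linear_on ::
    "'w::real_normed_vector set \<Rightarrow> ('w \<Rightarrow> real) \<Rightarrow> bool" where
  "bounded_linear_on D \<zeta> \<longleftrightarrow>
     (\<forall>F\<in>D. \<forall>G\<in>D. \<zeta> (F + G) = \<zeta> F + \<zeta> G) \<and>
     (\<forall>r. \<forall>F\<in>D. \<zeta> (r *\<^sub>R F) = r * \<zeta> F) \<and>
     (\<exists>K. \<forall>F\<in>D. \<bar>\<zeta> F\<bar> \<le> K * norm F)"

text \<open>Closure in the topology of pointwise convergence on \<open>D\<close>, spelled out with
  basic neighbourhoods that restrict finitely many coordinates; vectors of \<open>B\<close> act by
  evaluation.\<close>

definition pointwise_adherent ::
    "('v::real_normed_vector \<Rightarrow>\<^sub>L real) set \<Rightarrow> 'v set \<Rightarrow> (('v \<Rightarrow>\<^sub>L real) \<Rightarrow> real) \<Rightarrow> bool" where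
  "pointwise_adherent D B \<zeta> \<longleftrightarrow>
     (\<forall>E W. finite E \<and> E \<subseteq> D \<and> (\<forall>F\<in>E. open (W F) \<and> \<zeta> F \<in> W F) \<longrightarrow>
        (\<exists>b\<in>B. \<forall>F\<in>E. blinfun_apply F b \<in> W F))"

lemma pointwise_adherentD:
  assumes "pointwise_adherent D B \<zeta>" "finite E" "E \<subseteq> D" "\<forall>F\<in>E. open (W F) \<and> \<zeta> F \<in> W F"
  shows "\<exists>b\<in>B. \<forall>F\<in>E. blinfun_apply F b \<in> W F"
  using assms(1)[unfolded pointwise_adherent_def, rule_format, of E W] assms(2-4) by simp

context
  fixes N :: "'v::real_normed_vector set"
  assumes N: "subspace N"
begin

private abbreviation "Y \<equiv> quotient_space N"
private abbreviation "D \<equiv> annihilator N"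
private abbreviation "\<Phi> \<equiv> quotient_functional N"

lemma vecs_bidual_quotient_space:
  "z \<in> vecs (bidual_space Y) \<longleftrightarrow>
     z \<in> extensional (vecs (dual_space Y)) \<and> bounded_linear_on D (\<lambda>F. z (\<Phi> F))"
proof -
  have "bounded_functional (dual_space Y) z \<longleftrightarrow> bounded_linear_on D (\<lambda>F. z (\<Phi> F))"
    by (simp add: bounded_functional_def bounded_linear_on_def vecs_dual_quotient_space[OF N]
        vadd_quotient_functional[OF N] vscale_quotient_functional[OF N]
        vnorm_quotient_functional[OF N])
  then show ?thesis
    by (simp add: dual_space_def[of "dual_space Y"])
qed

lemma bidual_embedding_coset:
  "F \<in> D \<Longrightarrow> bidual_embedding Y (coset N v) (\<Phi> F) = blinfun_apply F v"
  by (simp add: bidual_embedding_def vecs_dual_quotient_space[OF N] quotient_functional_coset[OF N])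

lemma bidual_embedding_in_bidual: "bidual_embedding Y (coset N v) \<in> vecs (bidual_space Y)"
proof -
  have "\<bar>blinfun_apply F v\<bar> \<le> norm v * norm F" for F
    using norm_blinfun[of F v] by (simp add: mult.commute)
  then have "bounded_linear_on D (\<lambda>F. bidual_embedding Y (coset N v) (\<Phi> F))"
    unfolding bounded_linear_on_def
    by (auto simp: bidual_embedding_coset blinfun.add_left blinfun.scaleR_left
        subspace_add[OF subspace_annihilator] subspace_scale[OF subspace_annihilator])
  then show ?thesis
    by (simp add: vecs_bidual_quotient_space) (simp add: bidual_embedding_def)
qed

lemma unit_ball_bidual_quotient_space:
  "b \<in> unit_ball (bidual_space Y) \<longleftrightarrow>
     b \<in> vecs (bidual_space Y) \<and> (\<forall>F\<in>D. norm F \<le> 1 \<longrightarrow> \<bar>b (\<Phi> F)\<bar> \<le> 1)"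
proof (cases "b \<in> vecs (bidual_space Y)")
  case True
  then have "\<exists>K. \<forall>F\<in>D. \<bar>b (\<Phi> F)\<bar> \<le> K * norm F"
    by (simp add: vecs_bidual_quotient_space bounded_linear_on_def)
  then obtain K where K: "\<And>F. F \<in> D \<Longrightarrow> \<bar>b (\<Phi> F)\<bar> \<le> K * norm F"
    by blast
  have "\<bar>b (\<Phi> F)\<bar> \<le> \<bar>K\<bar>" if "F \<in> D" "norm F \<le> 1" for F
  proof -
    have "\<bar>b (\<Phi> F)\<bar> \<le> \<bar>K\<bar> * norm F"
      using K[OF that(1)] by (rule order_trans) (simp add: mult_right_mono)
    also have "\<dots> \<le> \<bar>K\<bar> * 1"
      by (intro mult_left_mono that) simp
    finally show ?thesis by simp
  qed
  \<comment> \<open>The real supremum defining the norm is informative only for a bounded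
    set.\<close>
  then have bdd: "bdd_above ((\<lambda>F. \<bar>b (\<Phi> F)\<bar>) ` {F \<in> D. norm F \<le> 1})"
    by (intro bdd_aboveI2[where M = "\<bar>K\<bar>"]) simp
  have ne: "{F \<in> D. norm F \<le> 1} \<noteq> {}"
    using subspace_0[OF subspace_annihilator[of N]] by (auto intro!: exI[of _ 0])
  have "vnorm (bidual_space Y) b = (SUP F\<in>{F \<in> D. norm F \<le> 1}. \<bar>b (\<Phi> F)\<bar>)"
    by (simp add: dual_space_def[of "dual_space Y"] unit_ball_dual_quotient_space[OF N] image_image)
  then show ?thesis
    using True cSUP_le_iff[OF ne bdd, of 1] by (auto simp: unit_ball_def)
qed (simp add: unit_ball_def)

text \<open>Basic boxes of the product topology constrain finitely many coordinates, and through the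
  injection \<open>\<Phi>\<close> these are finite subsets of the annihilator.\<close>

lemma weak_star_closure_quotient_space:
  "z \<in> weak_star_topology (dual_space Y) closure_of (bidual_embedding Y ` coset N ` B) \<longleftrightarrow>
     z \<in> vecs (bidual_space Y) \<and> pointwise_adherent D B (\<lambda>F. z (\<Phi> F))"
    (is "?lhs \<longleftrightarrow> ?rhs")
proof
  let ?T = "product_topology (\<lambda>_. euclideanreal) (vecs (dual_space Y))"
  assume ?lhs
  then have z: "z \<in> vecs (bidual_space Y)"
    and near: "\<And>S. openin ?T S \<Longrightarrow> z \<in> S \<Longrightarrow> \<exists>b\<in>B. bidual_embedding Y (coset N b) \<in> S"
    by (auto simp: in_closure_of weak_star_topology_def openin_subtopology)
  have "\<exists>b\<in>B. \<forall>F\<in>E. blinfun_apply F b \<in> W F"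
    if E: "finite E" "E \<subseteq> D" and W: "\<forall>F\<in>E. open (W F) \<and> z (\<Phi> F) \<in> W F" for E W
  proof -
    \<comment> \<open>The sets \<open>W F\<close> are moved to the coordinates
      \<open>\<Phi> F\<close>; all other coordinates stay free.\<close>
    define S where "S f = (if f \<in> \<Phi> ` E then W (inv_into D \<Phi> f) else UNIV)" for f
    have inv: "inv_into D \<Phi> (\<Phi> F) = F" if "F \<in> D" for F
      using inv_into_f_f[OF inj_on_quotient_functional[OF N] that] .
    have SE: "S (\<Phi> F) = W F" if "F \<in> E" for F
      using that E(2) inv[of F] by (auto simp: S_def)
    have "{f \<in> vecs (dual_space Y). S f \<noteq> UNIV} \<subseteq> \<Phi> ` E"
      by (auto simp: S_def)
    then have "finite {f \<in> vecs (dual_space Y). S f \<noteq> UNIV}"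
      using E(1) finite_subset by blast
    moreover have "open (S f)" for f
      using W E(2) inv by (auto simp: S_def)
    ultimately have "openin ?T (PiE (vecs (dual_space Y)) S)"
      by (simp add: openin_PiE_gen)
    moreover have "z \<in> PiE (vecs (dual_space Y)) S"
    proof (rule PiE_I)
      show "z f \<in> S f" for f
      proof (cases "f \<in> \<Phi> ` E")
        case True
        then obtain F where "F \<in> E" "f = \<Phi> F" by blast
        then show ?thesis using W SE by simp
      qed (simp add: S_def)
    qed (use z in \<open>auto simp: vecs_bidual_quotient_space extensional_def\<close>)
    ultimately obtain b where b: "b \<in> B"
        "bidual_embedding Y (coset N b) \<in> PiE (vecs (dual_space Y)) S"
      using near by blast
    have "blinfun_apply F b \<in> W F" if "F \<in> E" for F
    proof -
      have "\<Phi> F \<in> vecs (dual_space Y)"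
        using that E(2) by (auto simp: vecs_dual_quotient_space[OF N])
      then have "bidual_embedding Y (coset N b) (\<Phi> F) \<in> S (\<Phi> F)"
        using b(2) by blast
      then show ?thesis
        using bidual_embedding_coset[of F b] SE[OF that] that E(2) by auto
    qed
    with b(1) show ?thesis by blast
  qed
  with z show ?rhs
    by (simp add: pointwise_adherent_def)
next
  let ?T = "product_topology (\<lambda>_. euclideanreal) (vecs (dual_space Y))"
  assume rhs: ?rhs
  have "\<exists>b\<in>B. bidual_embedding Y (coset N b) \<in> S" if S: "openin ?T S" "z \<in> S" for S
  proof -
    obtain U where fin: "finite {f \<in> vecs (dual_space Y). U f \<noteq> UNIV}"
      and U: "\<forall>f\<in>vecs (dual_space Y). open (U f)" "z \<in> PiE (vecs (dual_space Y)) U"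
      and US: "PiE (vecs (dual_space Y)) U \<subseteq> S"
      using S unfolding openin_product_topology_alt by auto
    have dual: "\<Phi> F \<in> vecs (dual_space Y)" if "F \<in> D" for F
      using that by (simp add: vecs_dual_quotient_space[OF N])
    \<comment> \<open>Only the coordinates that the box really constrains are kept; there are
      finitely many.\<close>
    define E where "E = {F \<in> D. U (\<Phi> F) \<noteq> UNIV}"
    have "finite (\<Phi> ` E)"
      by (rule finite_subset[OF _ fin]) (auto simp: E_def dual)
    then have "finite E"
      by (rule finite_imageD) (rule inj_on_subset[OF inj_on_quotient_functional[OF N]], auto simp: E_def)
    moreover have "E \<subseteq> D" by (auto simp: E_def)
    moreover have "\<forall>F\<in>E. open (U (\<Phi> F)) \<and> z (\<Phi> F) \<in> U (\<Phi> F)"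
      using U dual by (auto simp: E_def PiE_iff)
    ultimately obtain b where b: "b \<in> B" "\<forall>F\<in>E. blinfun_apply F b \<in> U (\<Phi> F)"
      using pointwise_adherentD[OF conjunct2[OF rhs], of E "\<lambda>F. U (\<Phi> F)"] by blast
    have "bidual_embedding Y (coset N b) \<in> PiE (vecs (dual_space Y)) U"
    proof (rule PiE_I)
      fix f assume "f \<in> vecs (dual_space Y)"
      then obtain F where F: "F \<in> D" "f = \<Phi> F"
        by (auto simp: vecs_dual_quotient_space[OF N])
      then show "bidual_embedding Y (coset N b) f \<in> U f"
        using b(2) by (cases "F \<in> E") (auto simp: bidual_embedding_coset E_def)
    qed (simp add: bidual_embedding_def)
    with b(1) US show ?thesis by blast
  qed
  then show ?lhs
    using rhs bidual_embedding_in_bidual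
    by (fastforce simp: in_closure_of weak_star_topology_def openin_subtopology
        vecs_bidual_quotient_space PiE_iff)
qed

lemma bidual_enlargement_quotient_space:
  assumes z: "z \<in> vecs (bidual_space Y)" and "\<epsilon> > 0"
  shows "z \<in> {vadd (bidual_space Y) (bidual_embedding Y y) (vscale (bidual_space Y) \<epsilon> b) |y b.
            y \<in> vecs Y \<and> b \<in> unit_ball (bidual_space Y)} \<longleftrightarrow>
         (\<exists>v. \<forall>F\<in>D. norm F \<le> 1 \<longrightarrow> \<bar>z (\<Phi> F) - blinfun_apply F v\<bar> \<le> \<epsilon>)"
    (is "?lhs \<longleftrightarrow> ?rhs")
proof
  have dual: "\<Phi> F \<in> vecs (dual_space Y)" if "F \<in> D" for F
    using that by (simp add: vecs_dual_quotient_space[OF N])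
  assume ?lhs
  then obtain v b where zv: "z = vadd (bidual_space Y) (bidual_embedding Y (coset N v))
        (vscale (bidual_space Y) \<epsilon> b)" and b: "b \<in> unit_ball (bidual_space Y)"
    by (auto simp: vecs_quotient_space)
  have "\<bar>z (\<Phi> F) - blinfun_apply F v\<bar> \<le> \<epsilon>" if F: "F \<in> D" "norm F \<le> 1" for F
  proof -
    have "z (\<Phi> F) - blinfun_apply F v = \<epsilon> * b (\<Phi> F)"
      using dual[OF F(1)] bidual_embedding_coset[OF F(1)]
      by (simp add: zv dual_space_def[of "dual_space Y"])
    moreover have "\<bar>b (\<Phi> F)\<bar> \<le> 1"
      using b F by (simp add: unit_ball_bidual_quotient_space)
    ultimately show ?thesis
      using \<open>\<epsilon> > 0\<close> by (simp add: abs_mult mult_left_le)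
  qed
  then show ?rhs by blast
next
  have dual: "\<Phi> F \<in> vecs (dual_space Y)" if "F \<in> D" for F
    using that by (simp add: vecs_dual_quotient_space[OF N])
  assume ?rhs
  then obtain v where v: "\<And>F. F \<in> D \<Longrightarrow> norm F \<le> 1 \<Longrightarrow> \<bar>z (\<Phi> F) - blinfun_apply F v\<bar> \<le> \<epsilon>"
    by blast
  let ?J = "bidual_embedding Y (coset N v)"
  \<comment> \<open>The only candidate: \<open>b\<close> is obtained by solving the equation for
    \<open>z\<close>.\<close>
  define b where "b = restrict (\<lambda>f. (z f - ?J f) / \<epsilon>) (vecs (dual_space Y))"
  have b: "b (\<Phi> F) = (z (\<Phi> F) - blinfun_apply F v) / \<epsilon>" if "F \<in> D" for F
    using dual[OF that] bidual_embedding_coset[OF that] by (simp add: b_def)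
  have ext: "z \<in> extensional (vecs (dual_space Y))"
    and lin: "bounded_linear_on D (\<lambda>F. z (\<Phi> F))"
    using z by (auto simp: vecs_bidual_quotient_space)
  have "\<exists>K. \<forall>F\<in>D. \<bar>z (\<Phi> F)\<bar> \<le> K * norm F"
    using lin by (simp add: bounded_linear_on_def)
  then obtain K where K: "\<And>F. F \<in> D \<Longrightarrow> \<bar>z (\<Phi> F)\<bar> \<le> K * norm F"
    by blast
  have "bounded_linear_on D (\<lambda>F. b (\<Phi> F))"
    unfolding bounded_linear_on_def
  proof (intro conjI ballI allI exI)
    fix F G r assume "F \<in> D" "G \<in> D"
    then show "b (\<Phi> (F + G)) = b (\<Phi> F) + b (\<Phi> G)"
      using lin subspace_add[OF subspace_annihilator, of F N G] \<open>\<epsilon> > 0\<close>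
      by (simp add: b bounded_linear_on_def blinfun.add_left field_simps)
  next
    fix F r assume "F \<in> D"
    then show "b (\<Phi> (r *\<^sub>R F)) = r * b (\<Phi> F)"
      using lin subspace_scale[OF subspace_annihilator, of F N r] \<open>\<epsilon> > 0\<close>
      by (simp add: b bounded_linear_on_def blinfun.scaleR_left field_simps)
  next
    fix F assume F: "F \<in> D"
    have "\<bar>z (\<Phi> F) - blinfun_apply F v\<bar> \<le> (K + norm v) * norm F"
      using K[OF F] norm_blinfun[of F v] by (simp add: algebra_simps)
    then show "\<bar>b (\<Phi> F)\<bar> \<le> (K + norm v) / \<epsilon> * norm F"
      using \<open>\<epsilon> > 0\<close> by (simp add: b[OF F] divide_right_mono)
  qed
  then have "b \<in> vecs (bidual_space Y)"
    by (simp add: vecs_bidual_quotient_space) (simp add: b_def)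
  then have "b \<in> unit_ball (bidual_space Y)"
    using v \<open>\<epsilon> > 0\<close> by (simp add: unit_ball_bidual_quotient_space b)
  moreover have "z = vadd (bidual_space Y) ?J (vscale (bidual_space Y) \<epsilon> b)"
    by (rule extensionalityI[OF ext])
      (use \<open>\<epsilon> > 0\<close> in \<open>simp_all add: dual_space_def[of "dual_space Y"] b_def\<close>)
  ultimately show ?lhs
    by (auto simp: vecs_quotient_space)
qed

text \<open>This eliminates cosets and extensional functions from the measure of weak
  noncompactness: only vectors of the original space and functionals on the annihilator
  remain.\<close>

theorem weak_star_closure_subset_quotient_space:
  assumes "\<epsilon> > 0"
  shows "weak_star_topology (dual_space Y) closure_of (bidual_embedding Y ` coset N ` B) \<subseteq>
      {vadd (bidual_space Y) (bidual_embedding Y y) (vscale (bidual_space Y) \<epsilon> b) |y b.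
         y \<in> vecs Y \<and> b \<in> unit_ball (bidual_space Y)} \<longleftrightarrow>
    (\<forall>\<zeta>. bounded_linear_on D \<zeta> \<and> pointwise_adherent D B \<zeta> \<longrightarrow>
       (\<exists>v. \<forall>F\<in>D. norm F \<le> 1 \<longrightarrow> \<bar>\<zeta> F - blinfun_apply F v\<bar> \<le> \<epsilon>))"
    (is "?C \<subseteq> ?R \<longleftrightarrow> ?rhs")
proof
  assume sub: "?C \<subseteq> ?R"
  show ?rhs
  proof (intro allI impI, elim conjE)
    fix \<zeta> assume \<zeta>: "bounded_linear_on D \<zeta>" "pointwise_adherent D B \<zeta>"
    \<comment> \<open>The element of the bidual that corresponds to \<zeta>, transported along the
      inverse of \<open>\<Phi>\<close>.\<close>
    define z where "z = restrict (\<lambda>f. \<zeta> (inv_into D \<Phi> f)) (vecs (dual_space Y))"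
    have z: "z (\<Phi> F) = \<zeta> F" if "F \<in> D" for F
      using that inv_into_f_f[OF inj_on_quotient_functional[OF N] that]
      by (simp add: z_def vecs_dual_quotient_space[OF N])
    have "bounded_linear_on D (\<lambda>F. z (\<Phi> F))"
      using \<zeta>(1) by (simp add: bounded_linear_on_def z subspace_add[OF subspace_annihilator]
          subspace_scale[OF subspace_annihilator])
    then have vec: "z \<in> vecs (bidual_space Y)"
      by (simp add: vecs_bidual_quotient_space) (simp add: z_def)
    have "pointwise_adherent D B (\<lambda>F. z (\<Phi> F))"
      unfolding pointwise_adherent_def
    proof (intro allI impI, elim conjE)
      fix E W assume E: "finite E" "E \<subseteq> D" "\<forall>F\<in>E. open (W F) \<and> z (\<Phi> F) \<in> W F"
      have "\<forall>F\<in>E. open (W F) \<and> \<zeta> F \<in> W F"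
      proof
        fix F assume F: "F \<in> E"
        then have "z (\<Phi> F) = \<zeta> F"
          using E(2) by (intro z) blast
        then show "open (W F) \<and> \<zeta> F \<in> W F"
          using bspec[OF E(3) F] by simp
      qed
      with pointwise_adherentD[OF \<zeta>(2) E(1,2)]
      show "\<exists>b\<in>B. \<forall>F\<in>E. blinfun_apply F b \<in> W F" .
    qed
    with vec have "z \<in> ?R"
      using sub weak_star_closure_quotient_space by blast
    then show "\<exists>v. \<forall>F\<in>D. norm F \<le> 1 \<longrightarrow> \<bar>\<zeta> F - blinfun_apply F v\<bar> \<le> \<epsilon>"
      unfolding bidual_enlargement_quotient_space[OF vec assms] by (simp add: z)
  qed
next
  assume rhs: ?rhs
  show "?C \<subseteq> ?R"
  proof
    fix z assume "z \<in> ?C"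
    then have z: "z \<in> vecs (bidual_space Y)" "pointwise_adherent D B (\<lambda>F. z (\<Phi> F))"
      unfolding weak_star_closure_quotient_space by auto
    then have "bounded_linear_on D (\<lambda>F. z (\<Phi> F))"
      by (simp add: vecs_bidual_quotient_space)
    with rhs z show "z \<in> ?R"
      unfolding bidual_enlargement_quotient_space[OF z(1) assms] by blast
  qed
qed

end

section \<open>Functionals vanishing on finitely many vectors\<close>

lemma bounded_linear_on_linear:
  assumes "bounded_linear_on D \<zeta>"
  shows bounded_linear_on_add: "F \<in> D \<Longrightarrow> G \<in> D \<Longrightarrow> \<zeta> (F + G) = \<zeta> F + \<zeta> G"
    and bounded_linear_on_scale: "F \<in> D \<Longrightarrow> \<zeta> (r *\<^sub>R F) = r * \<zeta> F"
  using assms by (auto simp: bounded_linear_on_def)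

text \<open>A functional vanishing on the common kernel of finitely many evaluations is a
  combination of them. The induction generalizes \<open>D\<close>, passing to the subspace of
  functionals that vanish at one of the vectors.\<close>

lemma vanishing_on_kernels_imp_evaluation:
  fixes D :: "('v::real_normed_vector \<Rightarrow>\<^sub>L real) set"
  assumes "finite S" "subspace D"
    and "\<And>F G. F \<in> D \<Longrightarrow> G \<in> D \<Longrightarrow> g (F + G) = g F + g G"
    and "\<And>F r. F \<in> D \<Longrightarrow> g (r *\<^sub>R F) = r * g F"
    and "\<And>F. F \<in> D \<Longrightarrow> \<forall>y\<in>S. blinfun_apply F y = 0 \<Longrightarrow> g F = 0"
  shows "\<exists>v. \<forall>F\<in>D. g F = blinfun_apply F v"
  using assms
proof (induction S arbitrary: D)
  case empty
  then show ?case by (intro exI[of _ 0]) simp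
next
  case (insert y S)
  note D = insert.prems(1) and add = insert.prems(2) and scale = insert.prems(3)
  define D' where "D' = {F \<in> D. blinfun_apply F y = 0}"
  have D': "subspace D'"
    using D by (auto simp: subspace_def D'_def blinfun.add_left blinfun.scaleR_left)
  have "\<exists>v. \<forall>F\<in>D'. g F = blinfun_apply F v"
    by (rule insert.IH[OF D']) (use insert.prems in \<open>auto simp: D'_def\<close>)
  then obtain v where v: "\<And>F. F \<in> D' \<Longrightarrow> g F = blinfun_apply F v" by blast
  show ?case
  proof (cases "D' = D")
    case True
    with v show ?thesis by blast
  next
    case False
    then obtain e where e: "e \<in> D" "blinfun_apply e y \<noteq> 0"
      by (auto simp: D'_def)
    \<comment> \<open>The multiple of \<open>y\<close> is fitted so that the formula holds at
      \<open>e\<close>; adding a suitable multiple of \<open>e\<close> moves \<open>F\<close> into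
      \<open>D'\<close>, where \<open>v\<close> alone works.\<close>
    have "g F = blinfun_apply F (v + ((g e - blinfun_apply e v) / blinfun_apply e y) *\<^sub>R y)"
      if F: "F \<in> D" for F
    proof -
      define c where "c = - (blinfun_apply F y / blinfun_apply e y)"
      have ce: "c *\<^sub>R e \<in> D"
        using D e by (simp add: subspace_scale)
      have "F + c *\<^sub>R e \<in> D'"
        using subspace_add[OF D F ce] e
        by (simp add: D'_def blinfun.add_left blinfun.scaleR_left) (simp add: c_def)
      then have "g (F + c *\<^sub>R e) = blinfun_apply F v + c * blinfun_apply e v"
        using v by (simp add: blinfun.add_left blinfun.scaleR_left)
      moreover have "g (F + c *\<^sub>R e) = g F + c * g e"
        using add[OF F ce] scale[OF e(1)] by simp
      ultimately show ?thesis
        using e by (simp add: c_def blinfun.add_right blinfun.scaleR_right field_simps)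
    qed
    then show ?thesis by blast
  qed
qed

text \<open>
  A form of Helly's theorem: were the conclusion false, the restriction of \<open>\<zeta>\<close> to the functionals
  vanishing on \<open>S\<close> would have an extension of norm at most \<open>\<epsilon>\<close>, and the difference, being trivial on
  that subspace of finite codimension, would be an evaluation.
\<close>

lemma functional_vanishing_on_finite_set:
  fixes D :: "('v::real_normed_vector \<Rightarrow>\<^sub>L real) set"
  assumes D: "subspace D" and \<zeta>: "bounded_linear_on D \<zeta>" and "finite S" and "\<epsilon> \<ge> 0"
    and far: "\<And>v. \<exists>F\<in>D. norm F \<le> 1 \<and> \<bar>\<zeta> F - blinfun_apply F v\<bar> > \<epsilon>"
  shows "\<exists>F\<in>D. norm F \<le> 1 \<and> (\<forall>y\<in>S. blinfun_apply F y = 0) \<and> \<zeta> F > \<epsilon>"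
proof (rule ccontr)
  assume neg: "\<not> ?thesis"
  note add = bounded_linear_on_add[OF \<zeta>] and scale = bounded_linear_on_scale[OF \<zeta>]
  define L where "L = {F \<in> D. \<forall>y\<in>S. blinfun_apply F y = 0}"
  have L: "subspace L"
    using D by (auto simp: subspace_def L_def blinfun.add_left blinfun.scaleR_left)
  have LD: "F \<in> D" if "F \<in> L" for F
    using that by (simp add: L_def)
  have bound: "\<zeta> F \<le> \<epsilon> * norm F" if F: "F \<in> L" for F
  proof (cases "F = 0")
    case True
    then show ?thesis
      using scale[of 0 0] subspace_0[OF D] by simp
  next
    case False
    have "sgn F \<in> L"
      using subspace_scale[OF L F] by (simp add: sgn_div_norm)
    then have "\<zeta> (sgn F) \<le> \<epsilon>"
      using neg False by (force simp: L_def norm_sgn)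
    moreover have "\<zeta> (sgn F) = \<zeta> F / norm F"
      using scale[OF LD[OF F], of "inverse (norm F)"] by (simp add: sgn_div_norm divide_inverse)
    ultimately show ?thesis
      using False by (simp add: field_simps)
  qed
  \<comment> \<open>The graph of \<zeta> over the subspace \<open>L\<close> prescribes lower bounds
    at both \<open>F\<close> and \<open>- F\<close>, which forces \<open>w\<close> to agree with
    \<zeta> on \<open>L\<close>.\<close>
  let ?G = "(\<lambda>F. (F, \<zeta> F)) ` L"
  have G: "cone_closed ?G"
    unfolding cone_closed_def
  proof (intro conjI ballI allI impI)
    show "0 \<in> ?G"
      using subspace_0[OF L] scale[of 0 0] subspace_0[OF D] by (force simp: zero_prod_def)
  qed (use L LD in \<open>auto simp: image_iff add scale subspace_add subspace_scale\<close>)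
  have dom: "r \<le> \<epsilon> * norm F" if "(F, r) \<in> ?G" for F r
    using that bound by auto
  obtain w where w: "linear w" and w_le: "\<And>F. w F \<le> \<epsilon> * norm F"
    and w_ge: "\<And>F r. (F, r) \<in> ?G \<Longrightarrow> r \<le> w F"
    using mazur_orlicz[OF sublinear_norm[OF \<open>\<epsilon> \<ge> 0\<close>] G dom] by blast
  have w_eq: "w F = \<zeta> F" if F: "F \<in> L" for F
  proof -
    have "\<zeta> F \<le> w F"
      using w_ge F by blast
    moreover have "(- F, \<zeta> (- F)) \<in> ?G"
      using subspace_neg[OF L F] by blast
    then have "\<zeta> (- F) \<le> w (- F)"
      by (rule w_ge)
    moreover have "\<zeta> (- F) = - \<zeta> F"
      using scale[OF LD[OF F], of "- 1"] by simp
    ultimately show ?thesis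
      using linear_neg[OF w, of F] by simp
  qed
  have "\<exists>v. \<forall>F\<in>D. \<zeta> F - w F = blinfun_apply F v"
  proof (rule vanishing_on_kernels_imp_evaluation[OF \<open>finite S\<close> D])
    show "\<zeta> F - w F = 0" if "F \<in> D" "\<forall>y\<in>S. blinfun_apply F y = 0" for F
      using that w_eq[of F] by (simp add: L_def)
  qed (use w in \<open>simp_all add: add scale linear_add linear_cmul algebra_simps\<close>)
  then obtain v where v: "\<And>F. F \<in> D \<Longrightarrow> \<zeta> F - w F = blinfun_apply F v" by blast
  \<comment> \<open>On \<open>D\<close>, evaluation at \<open>v\<close> is \<zeta> minus
    \<open>w\<close>; so \<open>far\<close> at this \<open>v\<close> contradicts the norm bound on
    \<open>w\<close>.\<close>
  obtain F where F: "F \<in> D" "norm F \<le> 1" "\<bar>\<zeta> F - blinfun_apply F v\<bar> > \<epsilon>"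
    using far by blast
  then have "\<bar>w F\<bar> > \<epsilon>"
    using v[of F] by simp
  moreover have "\<bar>w F\<bar> \<le> \<epsilon> * norm F"
    using w_le[of F] w_le[of "- F"] linear_neg[OF w, of F] by simp
  moreover have "\<epsilon> * norm F \<le> \<epsilon> * 1"
    by (intro mult_left_mono F \<open>\<epsilon> \<ge> 0\<close>)
  ultimately show False by simp
qed

text \<open>The induction also carries \<open>\<zeta> (F k) > \<epsilon>\<close>. Helly's theorem
  supplies the next functional, vanishing on the earlier vectors; adherence then supplies a vector
  on which all functionals, old and new, exceed \<epsilon>.\<close>

lemma triangular_system_exists:
  fixes D :: "('v::real_normed_vector \<Rightarrow>\<^sub>L real) set"
  assumes D: "subspace D" and \<zeta>: "bounded_linear_on D \<zeta>" and B: "pointwise_adherent D B \<zeta>"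
    and "\<epsilon> \<ge> 0"
    and far: "\<And>v. \<exists>F\<in>D. norm F \<le> 1 \<and> \<bar>\<zeta> F - blinfun_apply F v\<bar> > \<epsilon>"
  shows "\<exists>y F. (\<forall>k\<in>{1..n::nat}. y k \<in> B \<and> F k \<in> D \<and> norm (F k) \<le> 1 \<and> \<zeta> (F k) > \<epsilon>) \<and>
    (\<forall>k\<in>{1..n}. \<forall>j\<in>{1..n}. (j < k \<longrightarrow> blinfun_apply (F k) (y j) = 0) \<and>
       (k \<le> j \<longrightarrow> blinfun_apply (F k) (y j) > \<epsilon>))"
proof (induction n)
  case 0
  then show ?case by simp
next
  case (Suc n)
  then obtain y F where
    y: "\<forall>k\<in>{1..n}. y k \<in> B \<and> F k \<in> D \<and> norm (F k) \<le> 1 \<and> \<zeta> (F k) > \<epsilon>" and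
    F: "\<forall>k\<in>{1..n}. \<forall>j\<in>{1..n}. (j < k \<longrightarrow> blinfun_apply (F k) (y j) = 0) \<and>
       (k \<le> j \<longrightarrow> blinfun_apply (F k) (y j) > \<epsilon>)"
    by (elim exE conjE)
  obtain G where G: "G \<in> D" "norm G \<le> 1" "\<forall>v\<in>y ` {1..n}. blinfun_apply G v = 0" "\<zeta> G > \<epsilon>"
    using functional_vanishing_on_finite_set[OF D \<zeta> _ \<open>\<epsilon> \<ge> 0\<close> far, of "y ` {1..n}"] by blast
  have "\<exists>b\<in>B. \<forall>H\<in>insert G (F ` {1..n}). blinfun_apply H b \<in> {\<epsilon><..}"
    by (rule pointwise_adherentD[OF B]) (use G y in auto)
  then obtain b where b: "b \<in> B" "blinfun_apply G b > \<epsilon>"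
      "\<And>k. k \<in> {1..n} \<Longrightarrow> blinfun_apply (F k) b > \<epsilon>"
    by auto
  let ?y = "y(Suc n := b)" and ?F = "F(Suc n := G)"
  have "?y k \<in> B \<and> ?F k \<in> D \<and> norm (?F k) \<le> 1 \<and> \<zeta> (?F k) > \<epsilon>" if "k \<in> {1..Suc n}" for k
    using that bspec[OF y, of k] G b(1) by (cases "k = Suc n") auto
  moreover have "(j < k \<longrightarrow> blinfun_apply (?F k) (?y j) = 0) \<and>
      (k \<le> j \<longrightarrow> blinfun_apply (?F k) (?y j) > \<epsilon>)"
    if "k \<in> {1..Suc n}" "j \<in> {1..Suc n}" for k j
    using that bspec[OF bspec[OF F, of k], of j] G(3) b(2) b(3)[of k] by (cases "k = Suc n"; cases "j = Suc n") auto
  ultimately show ?case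
    by (intro exI[of _ ?y] exI[of _ ?F]) blast
qed

section \<open>Passing from the ultrapower to the space\<close>

text \<open>Coefficients before index \<open>k\<close> take both signs, so the bound 0 there is
  two-sided and \<open>f\<close> vanishes; from \<open>k\<close> on they are nonnegative and force
  only the lower bound \<epsilon>.\<close>

lemma separating_functional_exists:
  fixes x :: "nat \<Rightarrow> 'a::real_normed_vector"
  assumes "1 \<le> k"
    and le: "\<And>c. (\<forall>j\<in>{k..m}. 0 \<le> c j) \<Longrightarrow>
      \<epsilon> * (\<Sum>j=k..m. c j) \<le> norm (\<Sum>j=1..m. c j *\<^sub>R x j)"
  shows "\<exists>f :: 'a \<Rightarrow>\<^sub>L real. norm f \<le> 1 \<and>
    (\<forall>j\<in>{1..m}. (j < k \<longrightarrow> blinfun_apply f (x j) = 0) \<and>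
      (k \<le> j \<longrightarrow> blinfun_apply f (x j) \<ge> \<epsilon>))"
proof -
  define g where "g c = ((\<Sum>j=1..m. c j *\<^sub>R x j), \<epsilon> * (\<Sum>j=k..m. c j))" for c :: "nat \<Rightarrow> real"
  let ?P = "{c. \<forall>j\<in>{k..m}. 0 \<le> c j}"
  have g_add: "g c + g d = g (\<lambda>j. c j + d j)" for c d
    by (simp add: g_def sum.distrib scaleR_add_left distrib_left)
  have g_scale: "t *\<^sub>R g c = g (\<lambda>j. t * c j)" for t c
    by (simp add: g_def scaleR_sum_right sum_distrib_left mult.left_commute)
  have G: "cone_closed (g ` ?P)"
    unfolding cone_closed_def
  proof (intro conjI ballI allI impI)
    show "0 \<in> g ` ?P"
      by (rule image_eqI[where x = "\<lambda>_. 0"]) (simp_all add: g_def zero_prod_def)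
  qed (auto simp: g_add g_scale)
  have dom: "r \<le> 1 * norm v" if "(v, r) \<in> g ` ?P" for v r
    using that le by (auto simp: g_def)
  obtain f where f: "linear f" "\<And>v. f v \<le> 1 * norm v" "\<And>v r. (v, r) \<in> g ` ?P \<Longrightarrow> r \<le> f v"
    using mazur_orlicz[OF sublinear_norm[of 1] G dom] by auto
  obtain F where F: "\<And>v. blinfun_apply F v = f v" "norm F \<le> 1"
    using linear_le_norm_blinfun[OF f(1)] f(2) by auto
  \<comment> \<open>Coefficients concentrated at one index isolate the condition on one
    vector.\<close>
  have unit: "g (\<lambda>i. if i = j then t else 0) = (t *\<^sub>R x j, if k \<le> j then \<epsilon> * t else 0)"
    if "j \<in> {1..m}" for j t
    using that by (auto simp: g_def if_distrib[of "\<lambda>t. t *\<^sub>R _"] cong: if_cong)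
  have "f (x j) = 0" if "j \<in> {1..m}" "j < k" for j
  proof -
    have "0 \<le> f (t *\<^sub>R x j)" for t
      by (rule f(3), rule image_eqI[where x = "\<lambda>i. if i = j then t else 0"])
        (use that unit[OF that(1), of t] in auto)
    from this[of 1] this[of "- 1"] show ?thesis
      by (simp add: linear_neg[OF f(1)])
  qed
  moreover have "f (x j) \<ge> \<epsilon>" if "j \<in> {1..m}" "k \<le> j" for j
    by (rule f(3), rule image_eqI[where x = "\<lambda>i. if i = j then 1 else 0"])
      (use that unit[OF that(1), of 1] in auto)
  ultimately show ?thesis
    using F by auto
qed

section \<open>Limits along a free ultrafilter and the ultrapower norm\<close>

lemma free_ultrafilter_not_eventually:
  "free_ultrafilter \<U> \<Longrightarrow> \<not> eventually P \<U> \<Longrightarrow> eventually (\<lambda>n. \<not> P n) \<U>"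
  by (auto simp: free_ultrafilter_def)

lemma free_ultrafilter_eventually_ge:
  assumes "free_ultrafilter \<U>"
  shows "eventually (\<lambda>n. n \<ge> m) \<U>"
proof (induction m)
  case (Suc m)
  have "eventually (\<lambda>n. n \<noteq> m) \<U>"
    using assms by (auto simp: free_ultrafilter_def)
  with Suc show ?case by eventually_elim simp
qed simp

text \<open>Compactness of \<open>cball 0 M\<close> gives a cluster point, and an ultrafilter
  converges to each of its cluster points.\<close>

lemma free_ultrafilter_convergent:
  fixes h :: "nat \<Rightarrow> real"
  assumes U: "free_ultrafilter \<U>" and h: "\<And>n. \<bar>h n\<bar> \<le> M"
  shows "(h \<longlongrightarrow> Lim \<U> h) \<U>"
proof -
  have bot: "\<U> \<noteq> bot"
    using U by (simp add: free_ultrafilter_def)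
  have "\<exists>L\<in>cball 0 M. inf (nhds L) (filtermap h \<U>) \<noteq> bot"
    using compact_cball[of "0 :: real" M] bot h unfolding compact_filter
    by (auto simp: filtermap_bot_iff eventually_filtermap)
  then obtain L where L: "inf (nhds L) (filtermap h \<U>) \<noteq> bot" by blast
  have "(h \<longlongrightarrow> L) \<U>"
    unfolding filterlim_def le_filter_def eventually_filtermap
  proof (intro allI impI, rule ccontr)
    fix P assume P: "eventually P (nhds L)" and "\<not> eventually (\<lambda>n. P (h n)) \<U>"
    then have "eventually (\<lambda>y. \<not> P y) (filtermap h \<U>)"
      using free_ultrafilter_not_eventually[OF U] by (simp add: eventually_filtermap)
    with P have "eventually (\<lambda>_. False) (inf (nhds L) (filtermap h \<U>))"
      unfolding eventually_inf by blast
    with L show False by (simp add: trivial_limit_def)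
  qed
  with tendsto_Lim[OF bot this] show ?thesis by simp
qed

text \<open>For a free ultrafilter this is the norm of the class of \<open>x\<close> in the
  ultrapower, by \<open>vnorm_ultrapower\<close>, viewed as a seminorm on bounded sequences.\<close>

definition ultra_norm :: "nat filter \<Rightarrow> (nat \<Rightarrow>\<^sub>C 'a::real_normed_vector) \<Rightarrow> real" where
  "ultra_norm \<U> x = Lim \<U> (\<lambda>n. norm (apply_bcontfun x n))"

context
  fixes \<U> :: "nat filter"
  assumes U: "free_ultrafilter \<U>"
begin

lemma ultrafilter_nontrivial: "\<U> \<noteq> bot"
  using U by (simp add: free_ultrafilter_def)

lemma tendsto_ultra_norm: "((\<lambda>n. norm (apply_bcontfun x n)) \<longlongrightarrow> ultra_norm \<U> x) \<U>"
  unfolding ultra_norm_def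
  by (rule free_ultrafilter_convergent[OF U, where M = "norm x"]) (simp add: norm_bounded)

lemma ultra_norm_le_norm: "ultra_norm \<U> x \<le> norm x"
  by (rule tendsto_upperbound[OF tendsto_ultra_norm _ ultrafilter_nontrivial]) (simp add: norm_bounded)

lemma ultra_norm_null_sequence: "x \<in> null_sequences \<U> \<Longrightarrow> ultra_norm \<U> x = 0"
  using tendsto_unique[OF ultrafilter_nontrivial tendsto_ultra_norm] by (simp add: null_sequences_def)

lemma sublinear_ultra_norm: "sublinear (ultra_norm \<U>)"
  unfolding sublinear_def
proof (intro conjI allI impI)
  fix x y
  show "ultra_norm \<U> (x + y) \<le> ultra_norm \<U> x + ultra_norm \<U> y"
    by (rule tendsto_le[OF ultrafilter_nontrivial tendsto_add[OF tendsto_ultra_norm tendsto_ultra_norm]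
          tendsto_ultra_norm]) (simp add: norm_triangle_ineq)
next
  fix t :: real and x assume "t \<ge> 0"
  then show "ultra_norm \<U> (t *\<^sub>R x) \<le> t * ultra_norm \<U> x"
    by (intro tendsto_le[OF ultrafilter_nontrivial tendsto_mult[OF tendsto_const tendsto_ultra_norm]
          tendsto_ultra_norm]) simp
qed

lemma annihilator_abs_le_ultra_norm:
  assumes F: "F \<in> annihilator (null_sequences \<U>)" and "norm F \<le> 1"
  shows "\<bar>blinfun_apply F x\<bar> \<le> ultra_norm \<U> x"
proof -
  have "0 \<le> ultra_norm \<U> x"
    by (rule tendsto_lowerbound[OF tendsto_ultra_norm _ ultrafilter_nontrivial]) simp
  moreover have "\<bar>blinfun_apply F x\<bar> \<le> norm F * ultra_norm \<U> x"
    using annihilator_abs_le[OF subspace_null_sequences F, of x]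
      vnorm_ultrapower[OF ultrafilter_nontrivial tendsto_ultra_norm, of x]
    by (simp add: ultrapower_def)
  ultimately show ?thesis
    using mult_right_mono[OF assms(2), of "ultra_norm \<U> x"] by simp
qed

text \<open>
  Should the separation fail along the ultrafilter, the limit of normalized coefficients of failing
  combinations would contradict either the values of \<open>F k\<close> or the triangularity of the system.
\<close>

lemma eventually_separating_functional:
  fixes y :: "nat \<Rightarrow> nat \<Rightarrow>\<^sub>C 'a::real_normed_vector"
  assumes "\<epsilon> > 0" and k: "k \<in> {1..m}"
    and F: "\<And>i. i \<in> {1..m} \<Longrightarrow> F i \<in> annihilator (null_sequences \<U>) \<and> norm (F i) \<le> 1"
    and zero: "\<And>i j. i \<in> {1..m} \<Longrightarrow> j \<in> {1..m} \<Longrightarrow> j < i \<Longrightarrow> blinfun_apply (F i) (y j) = 0"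
    and gt: "\<And>i j. i \<in> {1..m} \<Longrightarrow> j \<in> {1..m} \<Longrightarrow> i \<le> j \<Longrightarrow> blinfun_apply (F i) (y j) > \<epsilon>"
  shows "eventually (\<lambda>n. \<exists>f :: 'a \<Rightarrow>\<^sub>L real. norm f \<le> 1 \<and>
    (\<forall>j\<in>{1..m}. (j < k \<longrightarrow> blinfun_apply f (apply_bcontfun (y j) n) = 0) \<and>
      (k \<le> j \<longrightarrow> blinfun_apply f (apply_bcontfun (y j) n) \<ge> \<epsilon>))) \<U>"
proof (rule ccontr)
  assume neg: "\<not> ?thesis"
  \<comment> \<open>Coefficients witnessing failure at coordinate \<open>n\<close>, scaled to have
    absolute sum 1. The strict inequality is weakened to the form that survives a limit.\<close>
  define Q where "Q n c \<longleftrightarrow> (\<forall>j\<in>{k..m}. 0 \<le> c j) \<and> (\<Sum>j=1..m. \<bar>c j\<bar>) = 1 \<and>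
      norm (\<Sum>j=1..m. c j *\<^sub>R apply_bcontfun (y j) n) \<le> \<epsilon> * (\<Sum>j=k..m. c j)" for n and c :: "nat \<Rightarrow> real"
  have failing: "\<exists>c. Q n c"
    if "\<not> (\<exists>f :: 'a \<Rightarrow>\<^sub>L real. norm f \<le> 1 \<and>
      (\<forall>j\<in>{1..m}. (j < k \<longrightarrow> blinfun_apply f (apply_bcontfun (y j) n) = 0) \<and>
        (k \<le> j \<longrightarrow> blinfun_apply f (apply_bcontfun (y j) n) \<ge> \<epsilon>)))" for n
  proof -
    have "\<exists>c. (\<forall>j\<in>{k..m}. 0 \<le> c j) \<and>
        \<not> \<epsilon> * (\<Sum>j=k..m. c j) \<le> norm (\<Sum>j=1..m. c j *\<^sub>R apply_bcontfun (y j) n)"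
    proof (rule ccontr)
      assume "\<not> ?thesis"
      then have "\<epsilon> * (\<Sum>j=k..m. c j) \<le> norm (\<Sum>j=1..m. c j *\<^sub>R apply_bcontfun (y j) n)"
        if "\<forall>j\<in>{k..m}. 0 \<le> c j" for c
        using that by blast
      with k have "\<exists>f :: 'a \<Rightarrow>\<^sub>L real. norm f \<le> 1 \<and>
        (\<forall>j\<in>{1..m}. (j < k \<longrightarrow> blinfun_apply f (apply_bcontfun (y j) n) = 0) \<and>
          (k \<le> j \<longrightarrow> blinfun_apply f (apply_bcontfun (y j) n) \<ge> \<epsilon>))"
        by (intro separating_functional_exists) simp
      with that show False ..
    qed
    then obtain c where c: "\<forall>j\<in>{k..m}. 0 \<le> c j"
        "norm (\<Sum>j=1..m. c j *\<^sub>R apply_bcontfun (y j) n) < \<epsilon> * (\<Sum>j=k..m. c j)"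
      by (auto simp: not_le)
    define T where "T = (\<Sum>j=1..m. \<bar>c j\<bar>)"
    \<comment> \<open>The right-hand side exceeds a norm, so the coefficients from \<open>k\<close>
      on have positive sum and \<open>T\<close> may be divided by.\<close>
    have "0 < \<epsilon> * (\<Sum>j=k..m. c j)"
      using c(2) norm_ge_zero order_le_less_trans by blast
    then have "0 < (\<Sum>j=k..m. c j)"
      using \<open>\<epsilon> > 0\<close> by (simp add: zero_less_mult_iff)
    also have "\<dots> \<le> T"
      unfolding T_def using c(1) k
      by (intro order_trans[OF sum_mono[of "{k..m}" c "\<lambda>j. \<bar>c j\<bar>"] sum_mono2]) auto
    finally have "T > 0" .
    have "(\<Sum>j=1..m. (c j / T) *\<^sub>R apply_bcontfun (y j) n) =
        (1 / T) *\<^sub>R (\<Sum>j=1..m. c j *\<^sub>R apply_bcontfun (y j) n)"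
      by (simp add: scaleR_sum_right)
    then have "norm (\<Sum>j=1..m. (c j / T) *\<^sub>R apply_bcontfun (y j) n) \<le> \<epsilon> * (\<Sum>j=k..m. c j / T)"
      using c(2) \<open>T > 0\<close> by (simp add: sum_divide_distrib[symmetric] divide_right_mono)
    moreover have "(\<Sum>j=1..m. \<bar>c j / T\<bar>) = 1"
      using \<open>T > 0\<close> by (simp add: sum_divide_distrib[symmetric] T_def)
    ultimately have "Q n (\<lambda>j. c j / T)"
      using c(1) \<open>T > 0\<close> by (simp add: Q_def)
    then show ?thesis by blast
  qed
  \<comment> \<open>The default 0 keeps the coefficients bounded by 1 at every \<open>n\<close>, so
    that their limits exist.\<close>
  define c where "c n = (if \<exists>c. Q n c then SOME c. Q n c else (\<lambda>_. 0))" for n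
  have "eventually (\<lambda>n. \<exists>c. Q n c) \<U>"
    using free_ultrafilter_not_eventually[OF U neg] by eventually_elim (rule failing)
  then have Q: "eventually (\<lambda>n. Q n (c n)) \<U>"
    by eventually_elim (metis c_def someI_ex)
  have c_le: "\<bar>c n j\<bar> \<le> 1" if j: "j \<in> {1..m}" for n j
  proof (cases "\<exists>c. Q n c")
    case True
    then have "Q n (c n)"
      using someI_ex[OF True] by (simp add: c_def)
    then have "(\<Sum>j=1..m. \<bar>c n j\<bar>) = 1"
      by (simp add: Q_def)
    then show ?thesis
      using member_le_sum[OF j, of "\<lambda>j. \<bar>c n j\<bar>"] by simp
  qed (simp add: c_def)
  define a where "a j = Lim \<U> (\<lambda>n. c n j)" for j
  have a: "((\<lambda>n. c n j) \<longlongrightarrow> a j) \<U>" if "j \<in> {1..m}" for j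
    unfolding a_def by (rule free_ultrafilter_convergent[OF U c_le[OF that]])
  define s where "s = (\<Sum>j=1..m. a j *\<^sub>R y j)"
  have s_apply: "apply_bcontfun s n = (\<Sum>j=1..m. a j *\<^sub>R apply_bcontfun (y j) n)" for n
  proof -
    have "apply_bcontfun (\<Sum>j\<in>J. a j *\<^sub>R y j) n = (\<Sum>j\<in>J. a j *\<^sub>R apply_bcontfun (y j) n)"
      if "finite J" for J
      using that by induction auto
    then show ?thesis by (simp add: s_def)
  qed
  have a_nonneg: "0 \<le> a j" if j: "j \<in> {k..m}" for j
  proof (rule tendsto_lowerbound[OF a _ ultrafilter_nontrivial])
    show "eventually (\<lambda>n. 0 \<le> c n j) \<U>"
      using Q by eventually_elim (use j in \<open>simp add: Q_def\<close>)
  qed (use j k in auto)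
  have "((\<lambda>n. \<Sum>j=1..m. \<bar>c n j\<bar>) \<longlongrightarrow> (\<Sum>j=1..m. \<bar>a j\<bar>)) \<U>"
    by (intro tendsto_sum tendsto_rabs a)
  moreover have "((\<lambda>n. \<Sum>j=1..m. \<bar>c n j\<bar>) \<longlongrightarrow> 1) \<U>"
    by (rule tendsto_eventually) (use Q in eventually_elim, simp add: Q_def)
  ultimately have a_sum: "(\<Sum>j=1..m. \<bar>a j\<bar>) = 1"
    using tendsto_unique[OF ultrafilter_nontrivial] by blast
  have s_le: "ultra_norm \<U> s \<le> \<epsilon> * (\<Sum>j=k..m. a j)"
  proof (rule tendsto_le[OF ultrafilter_nontrivial _ tendsto_ultra_norm])
    \<comment> \<open>Replacing the limit coefficients \<open>a\<close> by \<open>c n\<close> costs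
      an error controlled by \<open>norm (y j)\<close>, which tends to 0.\<close>
    have "((\<lambda>n. \<epsilon> * (\<Sum>j=k..m. c n j) + (\<Sum>j=1..m. \<bar>a j - c n j\<bar> * norm (y j))) \<longlongrightarrow>
        \<epsilon> * (\<Sum>j=k..m. a j) + (\<Sum>j=1..m. \<bar>a j - a j\<bar> * norm (y j))) \<U>"
      using k by (intro tendsto_add tendsto_mult tendsto_const tendsto_sum tendsto_rabs tendsto_diff a) auto
    then show "((\<lambda>n. \<epsilon> * (\<Sum>j=k..m. c n j) + (\<Sum>j=1..m. \<bar>a j - c n j\<bar> * norm (y j))) \<longlongrightarrow>
        \<epsilon> * (\<Sum>j=k..m. a j)) \<U>" by simp
    show "eventually (\<lambda>n. norm (apply_bcontfun s n) \<le>
        \<epsilon> * (\<Sum>j=k..m. c n j) + (\<Sum>j=1..m. \<bar>a j - c n j\<bar> * norm (y j))) \<U>"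
      using Q
    proof eventually_elim
      case (elim n)
      have "apply_bcontfun s n = (\<Sum>j=1..m. c n j *\<^sub>R apply_bcontfun (y j) n) +
          (\<Sum>j=1..m. (a j - c n j) *\<^sub>R apply_bcontfun (y j) n)"
        by (simp add: s_apply sum.distrib[symmetric] scaleR_diff_left)
      also have "norm \<dots> \<le> norm (\<Sum>j=1..m. c n j *\<^sub>R apply_bcontfun (y j) n) +
          norm (\<Sum>j=1..m. (a j - c n j) *\<^sub>R apply_bcontfun (y j) n)"
        by (rule norm_triangle_ineq)
      also have "norm (\<Sum>j=1..m. (a j - c n j) *\<^sub>R apply_bcontfun (y j) n) \<le>
          (\<Sum>j=1..m. \<bar>a j - c n j\<bar> * norm (y j))"
        by (intro sum_norm_le) (simp add: norm_bounded mult_left_mono)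
      finally show ?case
        using elim by (simp add: Q_def)
    qed
  qed
  have F_s: "blinfun_apply (F i) s = (\<Sum>j=1..m. a j * blinfun_apply (F i) (y j))" for i
    by (simp add: s_def blinfun.sum_right blinfun.scaleR_right)
  \<comment> \<open>The value of \<open>F k\<close> at \<open>s\<close> is bounded by the seminorm
    of \<open>s\<close>, so a sum of nonnegative terms is at most 0. As \<open>F k\<close> strictly
    exceeds \<epsilon> on the vectors from \<open>k\<close> on, their coefficients vanish.\<close>
  have "blinfun_apply (F k) s = (\<Sum>j=k..m. a j * blinfun_apply (F k) (y j))"
    unfolding F_s using k zero by (intro sum.mono_neutral_right) auto
  moreover have "blinfun_apply (F k) s \<le> \<epsilon> * (\<Sum>j=k..m. a j)"
    using annihilator_abs_le_ultra_norm[of "F k" s] F[OF k] s_le by simp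
  ultimately have "(\<Sum>j=k..m. a j * (blinfun_apply (F k) (y j) - \<epsilon>)) \<le> 0"
    by (simp add: right_diff_distrib sum_subtractf sum_distrib_left mult.commute)
  moreover have nonneg: "0 \<le> a j * (blinfun_apply (F k) (y j) - \<epsilon>)" if "j \<in> {k..m}" for j
    using a_nonneg[OF that] gt[OF k, of j] that k by (intro mult_nonneg_nonneg) auto
  ultimately have "(\<Sum>j=k..m. a j * (blinfun_apply (F k) (y j) - \<epsilon>)) = 0"
    by (intro antisym sum_nonneg)
  then have "a j * (blinfun_apply (F k) (y j) - \<epsilon>) = 0" if "j \<in> {k..m}" for j
    using sum_nonneg_eq_0_iff[of "{k..m}" "\<lambda>j. a j * (blinfun_apply (F k) (y j) - \<epsilon>)"] nonneg that by auto
  then have "a j = 0" if "j \<in> {k..m}" for j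
    using that gt[OF k, of j] k by force
  \<comment> \<open>Hence \<open>s\<close> has seminorm 0 and every \<open>F i\<close> kills
    it.\<close>
  then have "ultra_norm \<U> s \<le> 0"
    using s_le by simp
  then have F_s0: "blinfun_apply (F i) s = 0" if "i \<in> {1..m}" for i
    using annihilator_abs_le_ultra_norm[of "F i" s] F[OF that] by simp
  \<comment> \<open>The coefficients are not all 0, as their absolute values sum to 1. At the last
    nonzero index \<open>l\<close>, triangularity leaves a single nonzero term in \<open>F l\<close>
    applied to \<open>s\<close>.\<close>
  define I where "I = {j \<in> {1..m}. a j \<noteq> 0}"
  have "finite I" "I \<noteq> {}"
    using a_sum sum.neutral[of "{1..m}" "\<lambda>j. \<bar>a j\<bar>"] by (force simp: I_def)+
  define l where "l = Max I"
  have "l \<in> I"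
    unfolding l_def using \<open>finite I\<close> \<open>I \<noteq> {}\<close> by (rule Max_in)
  then have l: "l \<in> {1..m}" "a l \<noteq> 0"
    by (auto simp: I_def)
  have top: "a j = 0" if "j \<in> {1..m}" "l < j" for j
  proof (rule ccontr)
    assume "a j \<noteq> 0"
    then have "j \<le> l"
      unfolding l_def using that by (intro Max_ge[OF \<open>finite I\<close>]) (simp add: I_def)
    with that show False by simp
  qed
  have "blinfun_apply (F l) s = (\<Sum>j\<in>{l}. a j * blinfun_apply (F l) (y j))"
    unfolding F_s using l(1) zero[OF l(1)] top
    by (intro sum.mono_neutral_right) (auto simp: nat_neq_iff)
  then show False
    using F_s0[OF l(1)] l gt[OF l(1) l(1)] \<open>\<epsilon> > 0\<close> by simp
qed

end

section \<open>The three inequalities\<close>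

text \<open>A convex combination involves finitely many points; a later hull can therefore start
  beyond all of them.\<close>

lemma convex_hull_tail_finite:
  fixes y :: "nat \<Rightarrow> 'v::real_vector"
  assumes "c \<in> convex hull (y ` {m..})"
  shows "\<exists>M\<ge>m. c \<in> convex hull (y ` {m..M})"
proof -
  obtain S u where S: "finite S" "S \<subseteq> y ` {m..}" "\<forall>x\<in>S. 0 \<le> u x" "sum u S = 1"
      "(\<Sum>v\<in>S. u v *\<^sub>R v) = c"
    using assms unfolding convex_hull_explicit by blast
  then have "c \<in> convex hull S"
    by (auto simp: convex_hull_finite)
  obtain K where K: "K \<subseteq> {m..}" "finite K" "S = y ` K"
    using finite_subset_image[OF S(1,2)] by blast
  have "K \<subseteq> {m..Max (insert m K)}"
    using K by auto
  then have "convex hull S \<subseteq> convex hull (y ` {m..Max (insert m K)})"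
    unfolding K(3) by (intro hull_mono image_mono)
  with \<open>c \<in> convex hull S\<close> show ?thesis
    using K(2) by (intro exI[of _ "Max (insert m K)"]) auto
qed

lemma triangular_imp_separated:
  assumes "triangular_sequences A \<epsilon> n"
  shows "separated_sequences A \<epsilon> n"
proof -
  obtain x f where x: "\<forall>k\<in>{1..n}. x k \<in> A \<and> norm (f k :: 'a \<Rightarrow>\<^sub>L real) \<le> 1"
    and f: "\<forall>k\<in>{1..n}. \<forall>j\<in>{1..n}. (j < k \<longrightarrow> blinfun_apply (f k) (x j) = 0) \<and>
      (j \<ge> k \<longrightarrow> blinfun_apply (f k) (x j) > \<epsilon>)"
    using assms unfolding triangular_sequences_def by (elim exE conjE)
  have "\<epsilon> \<le> setdist (convex hull (x ` {1..k})) (convex hull (x ` {k+1..n}))" if k: "k \<in> {1..<n}" for k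
  proof (rule le_setdistI)
    show "convex hull x ` {1..k} \<noteq> {}" "convex hull x ` {k+1..n} \<noteq> {}"
      using k by auto
    fix c d assume c: "c \<in> convex hull (x ` {1..k})" and d: "d \<in> convex hull (x ` {k+1..n})"
    \<comment> \<open>The index is \<open>k + 1\<close> because this functional still vanishes at
      \<open>x k\<close>, whereas \<open>f k\<close> already exceeds \<epsilon> there.\<close>
    let ?g = "blinfun_apply (f (k + 1))"
    have lin: "linear ?g"
      by (simp add: bounded_linear.linear blinfun.bounded_linear_right)
    have "?g c \<in> convex hull (?g ` x ` {1..k})"
      using c unfolding convex_hull_linear_image[OF lin, symmetric] by blast
    also have "\<dots> \<subseteq> {0}"
      using f k by (intro hull_minimal) auto
    finally have "?g c = 0" by simp
    have "?g d \<in> convex hull (?g ` x ` {k+1..n})"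
      using d unfolding convex_hull_linear_image[OF lin, symmetric] by blast
    also have "\<dots> \<subseteq> {\<epsilon>..}"
    proof (intro hull_minimal)
      have "\<epsilon> < ?g (x j)" if "j \<in> {k+1..n}" for j
        using bspec[OF bspec[OF f, of "k + 1"], of j] that k by auto
      then show "?g ` x ` {k+1..n} \<subseteq> {\<epsilon>..}" by fastforce
    qed simp
    finally have "\<epsilon> \<le> \<bar>?g (d - c)\<bar>"
      using \<open>?g c = 0\<close> by (simp add: blinfun.diff_right)
    also have "\<dots> \<le> norm (f (k + 1)) * norm (d - c)"
      using norm_blinfun[of "f (k + 1)" "d - c"] by simp
    also have "\<dots> \<le> 1 * norm (d - c)"
      using x k by (intro mult_right_mono) auto
    finally show "\<epsilon> \<le> dist c d"
      by (simp add: dist_norm norm_minus_commute)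
  qed
  with x show ?thesis
    unfolding separated_sequences_def by blast
qed

text \<open>Failure of the condition in \<open>Gamma2\<close> provides only arbitrarily long
  sequences; truncation supplies every length, as \<open>Gamma3\<close> requires.\<close>

lemma triangular_sequences_shorter:
  assumes "triangular_sequences A \<epsilon> n" "m \<le> n"
  shows "triangular_sequences A \<epsilon> m"
proof -
  obtain x f where x: "\<forall>k\<in>{1..n}. x k \<in> A \<and> norm (f k :: 'a \<Rightarrow>\<^sub>L real) \<le> 1"
    and f: "\<forall>k\<in>{1..n}. \<forall>j\<in>{1..n}. (j < k \<longrightarrow> blinfun_apply (f k) (x j) = 0) \<and>
      (j \<ge> k \<longrightarrow> blinfun_apply (f k) (x j) > \<epsilon>)"
    using assms(1) unfolding triangular_sequences_def by (elim exE conjE)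
  show ?thesis
    unfolding triangular_sequences_def
    by (intro exI[of _ x] exI[of _ f]) (use x f assms(2) in auto)
qed

section \<open>The first number expressed through the annihilator of the null sequences\<close>

definition noncompactness_bounds :: "nat filter \<Rightarrow> 'a::real_normed_vector set \<Rightarrow> real set" where
  "noncompactness_bounds \<U> A = {\<epsilon>. \<epsilon> > 0 \<and>
     (\<forall>\<zeta>. bounded_linear_on (annihilator (null_sequences \<U>)) \<zeta> \<and>
       pointwise_adherent (annihilator (null_sequences \<U>)) {v. \<forall>n. apply_bcontfun v n \<in> A} \<zeta> \<longrightarrow>
       (\<exists>v. \<forall>F\<in>annihilator (null_sequences \<U>). norm F \<le> 1 \<longrightarrow>
          \<bar>\<zeta> F - blinfun_apply F v\<bar> \<le> \<epsilon>))}"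

text \<open>A class in the ultrapower of \<open>A\<close> is the coset of its representative with
  entries in \<open>A\<close>, so the description of closures in a quotient applies.\<close>

lemma Gamma1_eq:
  fixes A :: "'a::banach set"
  shows "Gamma1 \<U> A = Inf (noncompactness_bounds \<U> A)"
proof -
  have "ultrapower_set \<U> A = coset (null_sequences \<U>) ` {v. \<forall>n. apply_bcontfun v n \<in> A}"
    (is "?L = ?R")
  proof (intro equalityI subsetI)
    fix C assume "C \<in> ?L"
    then obtain v x where v: "C = coset (null_sequences \<U>) v" "x \<in> C" "\<forall>n. apply_bcontfun x n \<in> A"
      by (auto simp: ultrapower_set_def ultrapower_def vecs_quotient_space)
    then have "C = coset (null_sequences \<U>) x"
      using coset_eq[OF subspace_null_sequences, of x v \<U>] by (simp add: mem_coset_iff)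
    with v show "C \<in> ?R" by blast
  next
    fix C assume "C \<in> ?R"
    then show "C \<in> ?L"
      using coset_self[OF subspace_null_sequences]
      by (fastforce simp: ultrapower_set_def ultrapower_def vecs_quotient_space)
  qed
  then show ?thesis
    unfolding Gamma1_def weak_noncompactness_def noncompactness_bounds_def ultrapower_def
    by (intro arg_cong[where f = Inf] Collect_cong conj_cong refl)
      (simp only: weak_star_closure_subset_quotient_space[OF subspace_null_sequences])
qed

context
  fixes \<U> :: "nat filter" and A :: "'a::banach set"
  assumes U: "free_ultrafilter \<U>"
begin

private abbreviation "\<D> \<equiv> annihilator (null_sequences \<U> :: (nat \<Rightarrow>\<^sub>C 'a) set)"
private abbreviation "B \<equiv> {v :: nat \<Rightarrow>\<^sub>C 'a. \<forall>n. apply_bcontfun v n \<in> A}"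

lemma triangular_sequences_if_not_bound:
  assumes "\<epsilon> > 0" "\<epsilon> \<notin> noncompactness_bounds \<U> A"
  shows "triangular_sequences A \<epsilon> m"
proof -
  obtain \<zeta> where \<zeta>: "bounded_linear_on \<D> \<zeta>" "pointwise_adherent \<D> B \<zeta>"
    and "\<not> (\<exists>v. \<forall>F\<in>\<D>. norm F \<le> 1 \<longrightarrow> \<bar>\<zeta> F - blinfun_apply F v\<bar> \<le> \<epsilon>)"
    using assms by (auto simp: noncompactness_bounds_def)
  then have far: "\<exists>F\<in>\<D>. norm F \<le> 1 \<and> \<bar>\<zeta> F - blinfun_apply F v\<bar> > \<epsilon>" for v
    by (meson not_le)
  obtain y F where y: "\<forall>k\<in>{1..m}. y k \<in> B \<and> F k \<in> \<D> \<and> norm (F k) \<le> 1 \<and> \<zeta> (F k) > \<epsilon>"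
    and F: "\<forall>k\<in>{1..m}. \<forall>j\<in>{1..m}. (j < k \<longrightarrow> blinfun_apply (F k) (y j) = 0) \<and>
      (k \<le> j \<longrightarrow> blinfun_apply (F k) (y j) > \<epsilon>)"
    using triangular_system_exists[OF subspace_annihilator \<zeta> less_imp_le[OF assms(1)] far, of m]
    by (elim exE conjE)
  \<comment> \<open>The coordinates inherit only a weak inequality, so some \<delta> is inserted
    strictly between \<epsilon> and these finitely many values.\<close>
  define V where "V = (\<lambda>(k, j). blinfun_apply (F k) (y j)) ` {(k, j) \<in> {1..m} \<times> {1..m}. k \<le> j}"
  have "finite V"
    unfolding V_def by (rule finite_imageI, rule finite_subset[of _ "{1..m} \<times> {1..m}"]) auto
  have V: "v > \<epsilon>" if "v \<in> V" for v
    using that F by (auto simp: V_def)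
  obtain \<delta> where \<delta>: "\<epsilon> < \<delta>" "\<forall>v\<in>V. \<delta> < v"
  proof (cases "V = {}")
    case True
    then show ?thesis using that[of "\<epsilon> + 1"] by simp
  next
    case False
    then have "\<epsilon> < Min V"
      using V \<open>finite V\<close> by simp
    then obtain \<delta> where "\<epsilon> < \<delta>" "\<delta> < Min V" using dense by blast
    then show ?thesis
      using \<open>finite V\<close> False by (intro that[of \<delta>]) auto
  qed
  have "eventually (\<lambda>n. \<exists>f :: 'a \<Rightarrow>\<^sub>L real. norm f \<le> 1 \<and>
      (\<forall>j\<in>{1..m}. (j < k \<longrightarrow> blinfun_apply f (apply_bcontfun (y j) n) = 0) \<and>
        (k \<le> j \<longrightarrow> blinfun_apply f (apply_bcontfun (y j) n) \<ge> \<delta>))) \<U>" if "k \<in> {1..m}" for k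
  proof (rule eventually_separating_functional[OF U _ that, where F = F])
    show "0 < \<delta>" using \<delta>(1) assms(1) by simp
    show "\<delta> < blinfun_apply (F i) (y j)" if "i \<in> {1..m}" "j \<in> {1..m}" "i \<le> j" for i j
      using \<delta>(2) that by (force simp: V_def)
  qed (use y F in auto)
  \<comment> \<open>Finitely many sets of the ultrafilter meet, so one coordinate \<open>n\<close>
    serves all \<open>k\<close>.\<close>
  then have "eventually (\<lambda>n. \<forall>k\<in>{1..m}. \<exists>f :: 'a \<Rightarrow>\<^sub>L real. norm f \<le> 1 \<and>
      (\<forall>j\<in>{1..m}. (j < k \<longrightarrow> blinfun_apply f (apply_bcontfun (y j) n) = 0) \<and>
        (k \<le> j \<longrightarrow> blinfun_apply f (apply_bcontfun (y j) n) \<ge> \<delta>))) \<U>"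
    by (intro eventually_ball_finite) auto
  then obtain n where "\<forall>k\<in>{1..m}. \<exists>f :: 'a \<Rightarrow>\<^sub>L real. norm f \<le> 1 \<and>
      (\<forall>j\<in>{1..m}. (j < k \<longrightarrow> blinfun_apply f (apply_bcontfun (y j) n) = 0) \<and>
        (k \<le> j \<longrightarrow> blinfun_apply f (apply_bcontfun (y j) n) \<ge> \<delta>))"
    using eventually_happens[OF _ ] ultrafilter_nontrivial[OF U] by blast
  then obtain f :: "nat \<Rightarrow> 'a \<Rightarrow>\<^sub>L real" where f: "\<forall>k\<in>{1..m}. norm (f k) \<le> 1 \<and>
      (\<forall>j\<in>{1..m}. (j < k \<longrightarrow> blinfun_apply (f k) (apply_bcontfun (y j) n) = 0) \<and>
        (k \<le> j \<longrightarrow> blinfun_apply (f k) (apply_bcontfun (y j) n) \<ge> \<delta>))"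
    by (elim bchoice[THEN exE])
  show ?thesis
    unfolding triangular_sequences_def
  proof (intro exI[of _ "\<lambda>j. apply_bcontfun (y j) n"] exI[of _ f] conjI ballI impI)
    fix k j assume kj: "k \<in> {1..m}" "j \<in> {1..m}"
    then have *: "(j < k \<longrightarrow> blinfun_apply (f k) (apply_bcontfun (y j) n) = 0) \<and>
        (k \<le> j \<longrightarrow> blinfun_apply (f k) (apply_bcontfun (y j) n) \<ge> \<delta>)"
      using f by blast
    show "blinfun_apply (f k) (apply_bcontfun (y j) n) = 0" if "j < k"
      using * that by blast
    show "blinfun_apply (f k) (apply_bcontfun (y j) n) > \<epsilon>" if "k \<le> j"
      using * that \<delta>(1) by force
  qed (use y f in auto)
qed

lemma separated_imp_le_bound:
  assumes A: "bounded A" and sep: "\<And>n. separated_sequences A \<epsilon> n"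
    and \<delta>: "\<delta> \<in> noncompactness_bounds \<U> A"
  shows "\<epsilon> \<le> 2 * \<delta>"
proof -
  note bot = ultrafilter_nontrivial[OF U]
  have "\<forall>n. \<exists>x :: nat \<Rightarrow> 'a. (\<forall>k\<in>{1..n}. x k \<in> A) \<and>
      (\<forall>k\<in>{1..<n}. setdist (convex hull (x ` {1..k})) (convex hull (x ` {k+1..n})) \<ge> \<epsilon>)"
    using sep unfolding separated_sequences_def by (rule allI)
  from choice[OF this] obtain x :: "nat \<Rightarrow> nat \<Rightarrow> 'a" where x: "\<forall>n. (\<forall>k\<in>{1..n}. x n k \<in> A) \<and>
      (\<forall>k\<in>{1..<n}. setdist (convex hull (x n ` {1..k})) (convex hull (x n ` {k+1..n})) \<ge> \<epsilon>)"
    ..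
  have xA: "x n k \<in> A" if "k \<in> {1..n}" for n k
    using x that by blast
  obtain M where M: "\<And>a. a \<in> A \<Longrightarrow> norm a \<le> M"
    using A by (auto simp: bounded_iff)
  \<comment> \<open>The \<open>k\<close>-th entries of the finite sequences, read along
    \<open>n\<close>. Where the sequence is too short the default is \<open>x 1 1\<close>, a point
    of \<open>A\<close>.\<close>
  define h where "h k n = (if k \<in> {1..n} then x n k else x 1 1)" for k n
  have hA: "h k n \<in> A" for k n
    using xA[of k n] xA[of 1 1] by (simp add: h_def)
  define y where "y k = Bcontfun (h k)" for k
  have y: "apply_bcontfun (y k) n = h k n" for k n
  proof -
    have "h k \<in> bcontfun"
      using M hA by (intro bcontfun_normI[of _ M]) auto
    then show ?thesis by (simp add: y_def Bcontfun_inverse)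
  qed
  have norm_y: "norm (y k) \<le> M" for k
    by (rule norm_bound) (simp add: y M hA)
  \<comment> \<open>The limit over \<open>k\<close> is taken along \<U> itself; since \<U> is free,
    it depends only on tails of \<open>y\<close>.\<close>
  define \<zeta> where "\<zeta> F = Lim \<U> (\<lambda>k. blinfun_apply F (y k))" for F :: "(nat \<Rightarrow>\<^sub>C 'a) \<Rightarrow>\<^sub>L real"
  have F_le: "\<bar>blinfun_apply F (y k)\<bar> \<le> M * norm F"
    for F :: "(nat \<Rightarrow>\<^sub>C 'a) \<Rightarrow>\<^sub>L real" and k
    using norm_blinfun[of F "y k"] mult_left_mono[OF norm_y[of k], of "norm F"]
    by (simp add: mult.commute)
  have \<zeta>: "((\<lambda>k. blinfun_apply F (y k)) \<longlongrightarrow> \<zeta> F) \<U>" for F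
    unfolding \<zeta>_def by (rule free_ultrafilter_convergent[OF U F_le])
  have "bounded_linear_on \<D> \<zeta>"
    unfolding bounded_linear_on_def
  proof (intro conjI ballI allI exI)
    show "\<zeta> (F + G) = \<zeta> F + \<zeta> G" for F G
      by (rule tendsto_unique[OF bot \<zeta>]) (simp add: blinfun.add_left tendsto_add \<zeta>)
    show "\<zeta> (r *\<^sub>R F) = r * \<zeta> F" for F r
      by (rule tendsto_unique[OF bot \<zeta>]) (simp add: blinfun.scaleR_left tendsto_mult \<zeta>)
    show "\<bar>\<zeta> F\<bar> \<le> M * norm F" for F
      by (rule tendsto_upperbound[OF tendsto_rabs[OF \<zeta>] _ bot]) (simp add: F_le)
  qed
  moreover have "pointwise_adherent \<D> B \<zeta>"
    unfolding pointwise_adherent_def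
  proof (intro allI impI, elim conjE)
    fix E W assume E: "finite E" and W: "\<forall>F\<in>E. open (W F) \<and> \<zeta> F \<in> W F"
    have "eventually (\<lambda>k. \<forall>F\<in>E. blinfun_apply F (y k) \<in> W F) \<U>"
      using W by (intro eventually_ball_finite[OF E]) (auto intro: topological_tendstoD[OF \<zeta>])
    then obtain k where "\<forall>F\<in>E. blinfun_apply F (y k) \<in> W F"
      using eventually_happens bot by blast
    moreover have "y k \<in> B" by (simp add: y hA)
    ultimately show "\<exists>b\<in>B. \<forall>F\<in>E. blinfun_apply F b \<in> W F" by blast
  qed
  ultimately obtain v where v: "\<forall>F\<in>\<D>. norm F \<le> 1 \<longrightarrow> \<bar>\<zeta> F - blinfun_apply F v\<bar> \<le> \<delta>"
    using \<delta> by (auto simp: noncompactness_bounds_def)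
  \<comment> \<open>Otherwise some functional in the unit ball of the annihilator separates
    \<open>v\<close> from the tail by \<open>\<delta>'\<close>, and the inequality passes to the
    limit \<zeta>.\<close>
  have near: "\<exists>c \<in> convex hull (y ` {m..}). ultra_norm \<U> (c - v) < \<delta>'" if "\<delta> < \<delta>'" for m \<delta>'
  proof (rule ccontr)
    assume "\<not> ?thesis"
    then have "\<delta>' \<le> ultra_norm \<U> c" if "c \<in> (\<lambda>c. c - v) ` (convex hull (y ` {m..}))" for c
      using that by force
    then obtain f where f: "linear f" and f_le: "\<And>u. f u \<le> ultra_norm \<U> u"
      and f_ge: "\<And>c. c \<in> (\<lambda>c. c - v) ` (convex hull (y ` {m..})) \<Longrightarrow> \<delta>' \<le> f c"
      by (rule separation_from_convex[OF sublinear_ultra_norm[OF U], rotated 2])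
        (auto intro: convex_translation_subtract)
    obtain F where F: "\<And>u. blinfun_apply F u = f u" "norm F \<le> 1"
      using linear_le_norm_blinfun[OF f order_trans[OF f_le ultra_norm_le_norm[OF U]]] by blast
    \<comment> \<open>The dominating seminorm vanishes at both \<open>u\<close> and
      \<open>- u\<close>.\<close>
    have "f u = 0" if "u \<in> null_sequences \<U>" for u
      using f_le[of u] f_le[of "- u"] that linear_neg[OF f, of u]
        ultra_norm_null_sequence[OF U that]
        ultra_norm_null_sequence[OF U subspace_neg[OF subspace_null_sequences that]]
      by simp
    then have "F \<in> \<D>"
      by (simp add: annihilator_def F)
    have "\<delta>' + blinfun_apply F v \<le> blinfun_apply F (y k)" if "m \<le> k" for k
      using f_ge[of "y k - v"] that hull_inc[of "y k" "y ` {m..}" convex]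
      by (auto simp: F linear_diff[OF f])
    then have "\<delta>' + blinfun_apply F v \<le> \<zeta> F"
      using free_ultrafilter_eventually_ge[OF U, of m]
      by (intro tendsto_lowerbound[OF \<zeta> _ bot]) (auto elim: eventually_mono)
    with v \<open>F \<in> \<D>\<close> F(2) \<open>\<delta> < \<delta>'\<close> show False by fastforce
  qed
  show ?thesis
  proof (rule field_le_epsilon)
    fix e :: real assume "e > 0"
    then have \<delta>': "\<delta> < \<delta> + e / 2" by simp
    obtain c where c: "c \<in> convex hull (y ` {1..})" "ultra_norm \<U> (c - v) < \<delta> + e / 2"
      using near[OF \<delta>'] by blast
    obtain m where m: "m \<ge> 1" "c \<in> convex hull (y ` {1..m})"
      using convex_hull_tail_finite[OF c(1)] by blast
    \<comment> \<open>This hull begins after the last index used for \<open>c\<close>, so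
      \<open>c\<close> and \<open>d\<close> lie on opposite sides of the cut at
      \<open>m\<close>.\<close>
    obtain d where d: "d \<in> convex hull (y ` {m+1..})" "ultra_norm \<U> (d - v) < \<delta> + e / 2"
      using near[OF \<delta>'] by blast
    obtain n0 where n0: "n0 \<ge> m + 1" "d \<in> convex hull (y ` {m+1..n0})"
      using convex_hull_tail_finite[OF d(1)] by blast
    \<comment> \<open>From \<open>n0\<close> on no default entry is involved: coordinate
      \<open>n\<close> of \<open>c\<close> and \<open>d\<close> lies in hulls of parts of the same
      separated sequence.\<close>
    have "\<epsilon> \<le> norm (apply_bcontfun (c - v) n) + norm (apply_bcontfun (d - v) n)" if n: "n \<ge> n0" for n
    proof -
      let ?ev = "\<lambda>u. apply_bcontfun u n"
      have lin: "linear ?ev" by (rule linearI) auto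
      have "?ev c \<in> convex hull (?ev ` y ` {1..m})"
        using m(2) unfolding convex_hull_linear_image[OF lin, symmetric] by blast
      also have "?ev ` y ` {1..m} = x n ` {1..m}"
        unfolding image_image using n n0(1) by (intro image_cong refl) (auto simp: y h_def)
      finally have cn: "?ev c \<in> convex hull (x n ` {1..m})" .
      have "?ev d \<in> convex hull (?ev ` y ` {m+1..n0})"
        using n0(2) unfolding convex_hull_linear_image[OF lin, symmetric] by blast
      also have "?ev ` y ` {m+1..n0} = x n ` {m+1..n0}"
        unfolding image_image using n by (intro image_cong refl) (auto simp: y h_def)
      also have "convex hull \<dots> \<subseteq> convex hull (x n ` {m+1..n})"
        using n by (intro hull_mono image_mono) auto
      finally have dn: "?ev d \<in> convex hull (x n ` {m+1..n})" .
      have "m \<in> {1..<n}"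
        using m(1) n0(1) n by auto
      then have "\<epsilon> \<le> setdist (convex hull (x n ` {1..m})) (convex hull (x n ` {m+1..n}))"
        using x by blast
      also have "\<dots> \<le> dist (?ev c) (?ev d)"
        by (rule setdist_le_dist[OF cn dn])
      also have "\<dots> = norm (?ev (c - v) - ?ev (d - v))"
        by (simp add: dist_norm)
      also have "\<dots> \<le> norm (?ev (c - v)) + norm (?ev (d - v))"
        by (rule norm_triangle_ineq4)
      finally show ?thesis .
    qed
    then have "\<epsilon> \<le> ultra_norm \<U> (c - v) + ultra_norm \<U> (d - v)"
      using free_ultrafilter_eventually_ge[OF U, of n0]
      by (intro tendsto_lowerbound[OF tendsto_add[OF tendsto_ultra_norm[OF U] tendsto_ultra_norm[OF U]] _ bot])
        (auto elim: eventually_mono)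
    also have "\<dots> \<le> 2 * \<delta> + e"
      using c(2) d(2) by simp
    finally show "\<epsilon> \<le> 2 * \<delta> + e" .
  qed
qed

end

theorem proposition3p2:
  fixes A :: "'a::banach set" and \<U> :: "nat filter"
  assumes "bounded A" and "free_ultrafilter \<U>"
  shows "Gamma1 \<U> A \<le> Gamma2 A \<and> Gamma2 A \<le> Gamma3 A \<and> Gamma3 A \<le> 2 * Gamma1 \<U> A"
proof -
  let ?S1 = "noncompactness_bounds \<U> A"
  let ?S2 = "{\<epsilon>. \<epsilon> > 0 \<and> (\<exists>N. \<forall>n\<ge>N. \<not> triangular_sequences A \<epsilon> n)}"
  let ?S3 = "{\<epsilon>. \<epsilon> > 0 \<and> (\<forall>n. separated_sequences A \<epsilon> n)}"
  have pos: "\<epsilon> > 0" if "\<epsilon> \<in> ?S1" for \<epsilon>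
    using that by (simp add: noncompactness_bounds_def)
  have S21: "?S2 \<subseteq> ?S1"
    using triangular_sequences_if_not_bound[OF assms(2)] by blast
  obtain M where M: "M > 0" "\<And>a. a \<in> A \<Longrightarrow> norm a \<le> M"
    using assms(1) by (auto simp: bounded_pos)
  \<comment> \<open>A norm bound for \<open>A\<close> excludes even length 1. The point is that both
    infima are then taken over nonempty sets.\<close>
  have "M \<in> ?S2"
  proof -
    have "\<not> triangular_sequences A M n" if "n \<ge> 1" for n
    proof
      assume "triangular_sequences A M n"
      then obtain x f where x: "\<forall>k\<in>{1..n}. x k \<in> A \<and> norm (f k :: 'a \<Rightarrow>\<^sub>L real) \<le> 1"
        and f: "\<forall>k\<in>{1..n}. \<forall>j\<in>{1..n}. (j < k \<longrightarrow> blinfun_apply (f k) (x j) = 0) \<and>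
          (j \<ge> k \<longrightarrow> blinfun_apply (f k) (x j) > M)"
        unfolding triangular_sequences_def by (elim exE conjE)
      have "1 \<in> {1..n}" using that by simp
      then have 1: "x 1 \<in> A" "norm (f 1) \<le> 1" "blinfun_apply (f 1) (x 1) > M"
        using x f by blast+
      have "\<bar>blinfun_apply (f 1) (x 1)\<bar> \<le> norm (f 1) * norm (x 1)"
        using norm_blinfun[of "f 1" "x 1"] by simp
      also have "\<dots> \<le> 1 * M"
        using 1 M by (intro mult_mono) auto
      finally show False using 1(3) by simp
    qed
    with M(1) show ?thesis by blast
  qed
  then have ne: "?S1 \<noteq> {}" "?S2 \<noteq> {}"
    using S21 by auto
  have bdd: "bdd_below ?S1" "bdd_below ?S2"
    using pos S21 by (auto intro!: bdd_belowI[of _ 0] less_imp_le)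
  have "Gamma1 \<U> A \<le> Gamma2 A"
    unfolding Gamma1_eq Gamma2_def by (rule cInf_superset_mono[OF ne(2) bdd(1) S21])
  moreover have le2: "\<epsilon> \<le> 2 * Gamma1 \<U> A" if "\<epsilon> \<in> ?S3" for \<epsilon>
  proof -
    have "\<epsilon> / 2 \<le> \<delta>" if "\<delta> \<in> ?S1" for \<delta>
      using separated_imp_le_bound[OF assms(2,1) _ that, of \<epsilon>] \<open>\<epsilon> \<in> ?S3\<close> by simp
    then have "\<epsilon> / 2 \<le> Inf ?S1"
      by (rule cInf_greatest[OF ne(1)])
    then show ?thesis
      unfolding Gamma1_eq by simp
  qed
  have "0 \<le> Gamma1 \<U> A"
    unfolding Gamma1_eq by (rule cInf_greatest[OF ne(1)]) (use pos in force)
  then have "Gamma3 A \<le> 2 * Gamma1 \<U> A"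
    using le2 unfolding Gamma3_def Let_def by (auto intro!: cSup_least)
  moreover have "Gamma2 A \<le> Gamma3 A"
  proof (rule ccontr)
    assume "\<not> Gamma2 A \<le> Gamma3 A"
    have S3: "\<epsilon> \<le> Gamma3 A" if "\<epsilon> \<in> ?S3" for \<epsilon>
    proof -
      have "bdd_above ?S3" using le2 by (rule bdd_aboveI)
      with that show ?thesis
        unfolding Gamma3_def Let_def by (auto intro: cSup_upper)
    qed
    \<comment> \<open>If no positive number qualifies, the convention for the empty supremum
      applies.\<close>
    have "0 \<le> Gamma3 A"
    proof (cases "?S3 = {}")
      case False
      then obtain \<epsilon> where "\<epsilon> \<in> ?S3" by blast
      then show ?thesis using S3[of \<epsilon>] by force
    qed (simp add: Gamma3_def)
    \<comment> \<open>Such a number is not in the set for \<open>Gamma2\<close>, so triangular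
      sequences of every length exist; being separated, they put it into the set whose supremum it
      exceeds.\<close>
    obtain \<epsilon> where \<epsilon>: "Gamma3 A < \<epsilon>" "\<epsilon> < Gamma2 A"
      using dense \<open>\<not> Gamma2 A \<le> Gamma3 A\<close> by (meson not_le)
    have "\<epsilon> \<notin> ?S2"
      using \<epsilon>(2) cInf_lower[OF _ bdd(2), of \<epsilon>] unfolding Gamma2_def by linarith
    moreover have "\<epsilon> > 0"
      using \<epsilon>(1) \<open>0 \<le> Gamma3 A\<close> by linarith
    ultimately have "\<exists>n\<ge>N. triangular_sequences A \<epsilon> n" for N
      by blast
    then have "triangular_sequences A \<epsilon> N" for N
      using triangular_sequences_shorter by blast
    then have "\<epsilon> \<in> ?S3"
      using \<open>\<epsilon> > 0\<close> triangular_imp_separated by blast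
    with S3 \<epsilon>(1) show False by fastforce
  qed
  ultimately show ?thesis by blast
qed

end
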